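(* Let $m\ge n>k\ge 1$ be integers and let $A\in\mathbb{R}^{m\times n}$ have singular values $\sigma_1\ge\sigma_2\ge\dots\ge\sigma_n\ge 0$ with $\sigma_k>0$. Let $A=U\Sigma V^T$ be a thin SVD of $A$, with $U=[U_k\ \ U_\perp]$ and $V=[V_k\ \ V_\perp]$, where $U_k\in\mathbb{R}^{m\times k}$ and $V_k\in\mathbb{R}^{n\times k}$ consist of the first $k$ columns. Let $\Omega\in\mathbb{R}^{m\times n}$ be a standard Gaussian random matrix, let $\Omega_1\in\mathbb{R}^{m\times k}$ be its first $k$ columns, and write $U^T\Omega_1=\begin{bmatrix}\widetilde\Omega_1\\ \widetilde\Omega_2\end{bmatrix}$ with $\widetilde\Omega_1\in\mathbb{R}^{k\times k}$ and $\widetilde\Omega_2\in\mathbb{R}^{(n-k)\times k}$. Let $A=QLP^T$ be the factorization produced by Rand-QLP (defined in the context) from $A$ and $\Omega$, and partition $Q=[Q_1\ \ Q_2]$, $P=[P_1\ \ P_2]$, $L=\begin{bmatrix}L_{11}&0\\ L_{21}&L_{22}\end{bmatrix}$, where $Q_1\in\mathbb{R}^{m\times k}$, $P_1\in\mathbb{R}^{n\times k}$, $L_{11}\in\mathbb{R}^{k\times k}$, $L_{22}\in\mathbb{R}^{(n-k)\times(n-k)}$. Let $\psi_k=\sigma_{k+1}/\sigma_k$ and define $$\sin\theta_Q=\mathrm{dist}(\mathcal R(U_k),\mathcal R(Q_1)),\quad \sin\phi_Q=\mathrm{dist}(\mathcal R(U_\perp),\mathcal R(Q_2)),$$ $$\sin\theta_P=\mathrm{dist}(\mathcal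 R(V_k),\mathcal R(P_1)),\quad \sin\phi_P=\mathrm{dist}(\mathcal R(V_\perp),\mathcal R(P_2)).$$ Then, on the event that $\widetilde\Omega_1$ is invertible (which has probability one), if $\|L_{22}\|_2<\sigma_k(L_{11})$, then $$\sin\theta_Q\le\psi_k^2\,\|\widetilde\Omega_2\widetilde\Omega_1^{-1}\|_2,\qquad \sin\theta_P\le\psi_k^3\,\|\widetilde\Omega_2\widetilde\Omega_1^{-1}\|_2,$$ $$\sin\phi_Q\le\frac{\psi_k^2\,\|\widetilde\Omega_2\widetilde\Omega_1^{-1}\|_2}{\sqrt{1+\psi_k^4\,\|\widetilde\Omega_2\widetilde\Omega_1^{-1}\|_2^2}},\qquad \sin\phi_P\le\frac{\psi_k^3\,\|\widetilde\Omega_2\widetilde\Omega_1^{-1}\|_2}{\sqrt{1+\psi_k^6\,\|\widetilde\Omega_2\widetilde\Omega_1^{-1}\|_2^2}}.$$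
   Context: Thin SVD: $A=U\Sigma V^T$ with $U\in\mathbb{R}^{m\times n}$ having orthonormal columns, $\Sigma=\mathrm{diag}(\sigma_1,\dots,\sigma_n)$, $\sigma_1\ge\dots\ge\sigma_n\ge0$, and $V\in\mathbb{R}^{n\times n}$ orthogonal. Rand-QLP: given $A\in\mathbb{R}^{m\times n}$ ($m\ge n$) and $\Omega\in\mathbb{R}^{m\times n}$ (with i.i.d. standard normal entries), perform three unpivoted (reduced) QR factorizations: (1) $A^T\Omega=\bar Q\bar R$, with $\bar Q\in\mathbb{R}^{n\times n}$ orthogonal and $\bar R\in\mathbb{R}^{n\times n}$ upper triangular; (2) $A\bar Q=Q\hat R$, with $Q\in\mathbb{R}^{m\times n}$ having orthonormal columns and $\hat R\in\mathbb{R}^{n\times n}$ upper triangular; (3) $(Q^TA)^T=A^TQ=PR$, with $P\in\mathbb{R}^{n\times n}$ orthogonal and $R\in\mathbb{R}^{n\times n}$ upper triangular. Set $L=R^T$. Then $A=QLP^T$ with $L$ lower triangular. $\mathcal R(\cdot)$ denotes the range (column space) and $\|\cdot\|_2$ the spectral norm; $\sigma_k(L_{11})$ is the $k$-th (smallest) singular value of $L_{11}$. For subspaces $S_1,S_2$ of the same dimension in $\mathbb{R}^d$, $\mathrm{dist}(S_1,S_2)=\|\Pi_{S_1}-\Pi_{S_2}\|_2$, where $\Pi_S$ is the orthogonal projector onto $S$; this is the sine of the largest canonical angle between $S_1$ and $S_2$.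
   Formalization: The bound on sin φ_Q is asserted only if m=n, or σ_n>0, or R(Q)=R(U); without this it is false for rank-deficient A with m>n, since R(U_⊥) and R(Q_2) are then not determined by A (e.g. A=e₁e₁ᵀ, 3×2, U=[e₁ e₂], Q=[e₁ e₃]). *)

theory Defs
  imports
    "HOL-Probability.Probability"
    "Jordan_Normal_Form.VS_Connect"
    "Jordan_Normal_Form.Char_Poly"
    "Jordan_Normal_Form.Gauss_Jordan_Elimination"
begin

hide_type (open) Finite_Cartesian_Product.vec
hide_const (open) Finite_Cartesian_Product.mat Finite_Cartesian_Product.vec

definition vec_norm2 :: "real Matrix.vec \<Rightarrow> real" where
  "vec_norm2 v = sqrt (scalar_prod v v)"

definition spectral_norm :: "real Matrix.mat \<Rightarrow> real" where
  "spectral_norm M = Sup {vec_norm2 (M *\<^sub>v x) | x. x \<in> carrier_vec (dim_col M) \<and> vec_norm2 x \<le> 1}"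

abbreviation range_mat :: "real Matrix.mat \<Rightarrow> real Matrix.vec set" where
  "range_mat M \<equiv> vec_space.col_space (dim_row M) M"

text \<open>The matrix of the orthogonal projector of \<open>\<real>\<^sup>d\<close> onto the subspace \<open>S\<close>.\<close>

definition orth_projector :: "nat \<Rightarrow> real Matrix.vec set \<Rightarrow> real Matrix.mat" where
  "orth_projector d S = (THE E. E \<in> carrier_mat d d \<and>
     (\<forall>x \<in> carrier_vec d. E *\<^sub>v x \<in> S \<and> (\<forall>y \<in> S. scalar_prod (x - E *\<^sub>v x) y = 0)))"

lemma mat_unit_vec_col:
  fixes M :: "real Matrix.mat"
  assumes "M \<in> carrier_mat r c" "j < c"
  shows "M *\<^sub>v unit_vec c j = col M j"
proof (rule eq_vecI)
  fix i assume "i < dim_vec (col M j)"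
  then have i: "i < r" using assms by simp
  have "Matrix.vec_index (M *\<^sub>v unit_vec c j) i = scalar_prod (Matrix.row M i) (unit_vec c j)"
    using i assms by simp
  also have "\<dots> = Matrix.vec_index (Matrix.row M i) j"
    by (rule Matrix.scalar_prod_right_unit[OF assms(2)])
  finally show "Matrix.vec_index (M *\<^sub>v unit_vec c j) i = Matrix.vec_index (col M j) i"
    using i assms by simp
qed (use assms in auto)

lemma orth_projector_range:
  assumes B: "B \<in> carrier_mat d r" "B\<^sup>T * B = 1\<^sub>m r"
  shows "orth_projector d (range_mat B) = B * B\<^sup>T"
proof -
  interpret vec_space "TYPE(real)" d .
  have R: "range_mat B = {y \<in> carrier_vec d. \<exists>x \<in> carrier_vec r. B *\<^sub>v x = y}"
    using col_space_eq[OF B(1)] B(1) by auto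
  let ?P = "\<lambda>E. E \<in> carrier_mat d d \<and> (\<forall>x \<in> carrier_vec d. E *\<^sub>v x \<in> range_mat B \<and>
      (\<forall>y \<in> range_mat B. scalar_prod (x - E *\<^sub>v x) y = 0))"
  have key: "E *\<^sub>v x = B *\<^sub>v (B\<^sup>T *\<^sub>v x)" if E: "?P E" and x: "x \<in> carrier_vec d" for E x
  proof -
    obtain z where z: "z \<in> carrier_vec r" "E *\<^sub>v x = B *\<^sub>v z"
      using E x unfolding R by force
    have "B\<^sup>T *\<^sub>v (x - B *\<^sub>v z) = 0\<^sub>v r"
    proof (rule eq_vecI)
      fix i assume "i < dim_vec (0\<^sub>v r :: real Matrix.vec)"
      then have i: "i < r" by simp
      have "col B i = B *\<^sub>v unit_vec r i" using B(1) i by (simp add: mat_unit_vec_col)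
      then have "col B i \<in> range_mat B" unfolding R using B(1) i by force
      then have "scalar_prod (x - B *\<^sub>v z) (col B i) = 0" using E x z by metis
      then show "Matrix.vec_index (B\<^sup>T *\<^sub>v (x - B *\<^sub>v z)) i = Matrix.vec_index (0\<^sub>v r) i"
        using B(1) x i z comm_scalar_prod[of "col B i" d "x - B *\<^sub>v z"] by auto
    qed (use B in auto)
    also have "B\<^sup>T *\<^sub>v (x - B *\<^sub>v z) = B\<^sup>T *\<^sub>v x - B\<^sup>T *\<^sub>v (B *\<^sub>v z)"
      using B(1) x z by (intro mult_minus_distrib_mat_vec) auto
    also have "B\<^sup>T *\<^sub>v (B *\<^sub>v z) = z"
      using B z assoc_mult_mat_vec[of "B\<^sup>T" r d B r z] by simp
    finally have "B\<^sup>T *\<^sub>v x - z = 0\<^sub>v r" .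
    moreover have "B\<^sup>T *\<^sub>v x \<in> carrier_vec r" using B x by auto
    ultimately have "B\<^sup>T *\<^sub>v x = z" using z(1) B(1)
      by (intro eq_vecI) (auto dest!: arg_cong[of _ _ "\<lambda>v. Matrix.vec_index v i" for i] simp: vec_eq_iff)
    then show ?thesis using z by simp
  qed
  have ex: "?P (B * B\<^sup>T)"
  proof (intro conjI ballI)
    show "B * B\<^sup>T \<in> carrier_mat d d" using B by auto
    fix x :: "real Matrix.vec" assume x: "x \<in> carrier_vec d"
    have e: "(B * B\<^sup>T) *\<^sub>v x = B *\<^sub>v (B\<^sup>T *\<^sub>v x)" using B x assoc_mult_mat_vec[of B d r "B\<^sup>T" d x] by simp
    have bx: "B\<^sup>T *\<^sub>v x \<in> carrier_vec r" using B x by auto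
    show "(B * B\<^sup>T) *\<^sub>v x \<in> range_mat B" unfolding e R using B x bx by auto
    fix y assume "y \<in> range_mat B"
    then obtain z where z: "z \<in> carrier_vec r" "y = B *\<^sub>v z" unfolding R by auto
    have c: "x - B *\<^sub>v (B\<^sup>T *\<^sub>v x) \<in> carrier_vec d" using B x bx by auto
    have "B\<^sup>T *\<^sub>v (x - B *\<^sub>v (B\<^sup>T *\<^sub>v x)) = B\<^sup>T *\<^sub>v x - B\<^sup>T *\<^sub>v (B *\<^sub>v (B\<^sup>T *\<^sub>v x))"
      using B(1) x bx by (intro mult_minus_distrib_mat_vec) auto
    also have "B\<^sup>T *\<^sub>v (B *\<^sub>v (B\<^sup>T *\<^sub>v x)) = B\<^sup>T *\<^sub>v x"
      using B bx assoc_mult_mat_vec[of "B\<^sup>T" r d B r "B\<^sup>T *\<^sub>v x"] by simp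
    finally have 0: "B\<^sup>T *\<^sub>v (x - B *\<^sub>v (B\<^sup>T *\<^sub>v x)) = 0\<^sub>v r" using bx by simp
    have "scalar_prod (x - (B * B\<^sup>T) *\<^sub>v x) y = scalar_prod (B\<^sup>T *\<^sub>v (x - B *\<^sub>v (B\<^sup>T *\<^sub>v x))) z"
      unfolding e z(2) using transpose_vec_mult_scalar[OF B(1) z(1) c] by simp
    then show "scalar_prod (x - (B * B\<^sup>T) *\<^sub>v x) y = 0" unfolding 0 using z by simp
  qed
  show ?thesis unfolding orth_projector_def
  proof (rule the_equality[where P = ?P, OF ex])
    fix E assume E: "?P E"
    show "E = B * B\<^sup>T"
    proof (rule eq_matI)
      fix i j assume "i < dim_row (B * B\<^sup>T)" "j < dim_col (B * B\<^sup>T)"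
      then have ij: "i < d" "j < d" using B by auto
      have u: "unit_vec d j \<in> carrier_vec d" by simp
      have "E *\<^sub>v unit_vec d j = (B * B\<^sup>T) *\<^sub>v unit_vec d j"
        using key[OF E u] key[OF ex u] by simp
      then have "col E j = col (B * B\<^sup>T) j"
        using E ij B by (simp add: mat_unit_vec_col[of _ d d])
      then show "E $$ (i, j) = (B * B\<^sup>T) $$ (i, j)"
        using ij E B by (metis carrier_matD(1) carrier_matD(2) index_col index_mult_mat(2) index_mult_mat(3) index_transpose_mat(3))
    qed (use E B in auto)
  qed
qed

definition subspace_dist :: "nat \<Rightarrow> real Matrix.vec set \<Rightarrow> real Matrix.vec set \<Rightarrow> real" where
  "subspace_dist d S T = spectral_norm (orth_projector d S - orth_projector d T)"

definition left_cols :: "nat \<Rightarrow> 'a Matrix.mat \<Rightarrow> 'a Matrix.mat" where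
  "left_cols k M = Matrix.mat (dim_row M) k (\<lambda>(i, j). M $$ (i, j))"

definition right_cols :: "nat \<Rightarrow> 'a Matrix.mat \<Rightarrow> 'a Matrix.mat" where
  "right_cols k M = Matrix.mat (dim_row M) (dim_col M - k) (\<lambda>(i, j). M $$ (i, j + k))"

definition top_rows :: "nat \<Rightarrow> 'a Matrix.mat \<Rightarrow> 'a Matrix.mat" where
  "top_rows k M = Matrix.mat k (dim_col M) (\<lambda>(i, j). M $$ (i, j))"

definition bottom_rows :: "nat \<Rightarrow> 'a Matrix.mat \<Rightarrow> 'a Matrix.mat" where
  "bottom_rows k M = Matrix.mat (dim_row M - k) (dim_col M) (\<lambda>(i, j). M $$ (i + k, j))"

text \<open>Singular values are counted from 1 and in decreasing order.\<close>

definition thin_svd ::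
  "real Matrix.mat \<Rightarrow> real Matrix.mat \<Rightarrow> (nat \<Rightarrow> real) \<Rightarrow> real Matrix.mat \<Rightarrow> bool" where
  "thin_svd A U \<sigma> V \<longleftrightarrow>
     U \<in> carrier_mat (dim_row A) (dim_col A) \<and> U\<^sup>T * U = 1\<^sub>m (dim_col A) \<and>
     V \<in> carrier_mat (dim_col A) (dim_col A) \<and> V\<^sup>T * V = 1\<^sub>m (dim_col A) \<and>
     (\<forall>i \<in> {1..dim_col A}. \<sigma> i \<ge> 0) \<and>
     (\<forall>i \<in> {1..dim_col A}. \<forall>j \<in> {1..dim_col A}. i \<le> j \<longrightarrow> \<sigma> j \<le> \<sigma> i) \<and>
     A = U * mat_diag (dim_col A) (\<lambda>i. \<sigma> (Suc i)) * V\<^sup>T"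

text \<open>The square roots of the eigenvalues of \<open>M\<^sup>T M\<close>, with multiplicity; by
  \<open>thin_svd_singular_value\<close> below they are the \<open>\<sigma>\<close> of any thin SVD of \<open>M\<close>.\<close>

definition singular_values :: "real Matrix.mat \<Rightarrow> real list" where
  "singular_values M = rev (sorted_list_of_multiset (image_mset sqrt (proots (char_poly (M\<^sup>T * M)))))"

definition singular_value :: "real Matrix.mat \<Rightarrow> nat \<Rightarrow> real" where
  "singular_value M i = singular_values M ! (i - 1)"

lemma thin_svd_singular_value:
  assumes svd: "thin_svd A U \<sigma> V" and i: "1 \<le> i" "i \<le> dim_col A"
  shows "singular_value A i = \<sigma> i"
proof -
  define n where "n = dim_col A"
  define S where "S = mat_diag n (\<lambda>i. \<sigma> (Suc i))"
  define D where "D = mat_diag n (\<lambda>i. \<sigma> (Suc i) ^ 2)"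
  have U: "U \<in> carrier_mat (dim_row A) n" "U\<^sup>T * U = 1\<^sub>m n"
    and V: "V \<in> carrier_mat n n" "V\<^sup>T * V = 1\<^sub>m n"
    and nonneg: "\<And>i. i < n \<Longrightarrow> \<sigma> (Suc i) \<ge> 0"
    and decr: "\<And>i j. i \<le> j \<Longrightarrow> j < n \<Longrightarrow> \<sigma> (Suc j) \<le> \<sigma> (Suc i)"
    and A: "A = U * S * V\<^sup>T"
    using svd unfolding thin_svd_def n_def S_def by auto
  have S: "S \<in> carrier_mat n n" "S\<^sup>T = S" and D: "D \<in> carrier_mat n n"
    unfolding S_def D_def by (auto simp: mat_diag_def)
  have SS: "S * S = D" unfolding S_def D_def by (simp add: power2_eq_square)
  have VV: "V * V\<^sup>T = 1\<^sub>m n" using mat_mult_left_right_inverse[OF _ V(1) V(2)] V(1) by simp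
  have AT: "A\<^sup>T = V * (S * U\<^sup>T)"
  proof -
    have "(U * S * V\<^sup>T)\<^sup>T = V * (S\<^sup>T * U\<^sup>T)"
      using transpose_mult[of "U * S" "dim_row A" n "V\<^sup>T" n] transpose_mult[OF U(1) S(1)] U(1) V(1) S(1) by simp
    then show ?thesis unfolding S(2) using A by metis
  qed
  have "A\<^sup>T * A = V * (S * U\<^sup>T) * (U * (S * V\<^sup>T))"
    unfolding AT using U V S A by (metis assoc_mult_mat transpose_carrier_mat)
  also have "\<dots> = V * (S * ((U\<^sup>T * U) * (S * V\<^sup>T)))"
    using U(1) V(1) S(1) by (smt (verit) assoc_mult_mat mult_carrier_mat transpose_carrier_mat)
  also have "\<dots> = V * ((S * S) * V\<^sup>T)"
    using U V(1) S(1) by (simp add: assoc_mult_mat[of _ n n _ n _ n])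
  also have "\<dots> = V * D * V\<^sup>T"
    unfolding SS using V(1) D by (simp add: assoc_mult_mat[of _ n n _ n _ n])
  finally have *: "A\<^sup>T * A = V * D * V\<^sup>T" .
  have "similar_mat (A\<^sup>T * A) D"
    unfolding similar_mat_def similar_mat_wit_def
    by (rule exI[of _ V], rule exI[of _ "V\<^sup>T"]) (use V VV D * in \<open>auto simp: Let_def\<close>)
  then have "char_poly (A\<^sup>T * A) = char_poly D"
    by (rule char_poly_similar)
  also have "\<dots> = (\<Prod>a\<leftarrow>diag_mat D. [:- a, 1:])"
    by (rule char_poly_upper_triangular[OF D]) (auto simp: D_def mat_diag_def upper_triangular_def)
  also have "diag_mat D = map (\<lambda>i. \<sigma> (Suc i) ^ 2) [0..<n]"
    unfolding diag_mat_def D_def by (auto simp: mat_diag_def)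
  finally have cp: "char_poly (A\<^sup>T * A) = (\<Prod>i\<leftarrow>[0..<n]. [:- (\<sigma> (Suc i) ^ 2), 1:])"
    by (simp add: o_def)
  have pr: "proots (\<Prod>i\<leftarrow>xs. [:- (f i), 1:]) = mset (map f xs)" for f :: "nat \<Rightarrow> real" and xs
  proof (induction xs)
    case (Cons a xs)
    have "(\<Prod>i\<leftarrow>xs. [:- (f i), 1:]) \<noteq> 0" by (auto simp: prod_list_zero_iff)
    then show ?case using Cons by (simp add: proots_mult del: mult_pCons_left mult_pCons_right)
  qed simp
  let ?l = "map (\<lambda>i. \<sigma> (Suc i)) [0..<n]"
  have "image_mset sqrt (proots (char_poly (A\<^sup>T * A))) = mset (map sqrt (map (\<lambda>i. \<sigma> (Suc i) ^ 2) [0..<n]))"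
    unfolding cp pr mset_map ..
  also have "map sqrt (map (\<lambda>i. \<sigma> (Suc i) ^ 2) [0..<n]) = ?l"
    using nonneg by auto
  finally have "singular_values A = rev (sorted_list_of_multiset (mset ?l))"
    unfolding singular_values_def by simp
  also have "sorted_list_of_multiset (mset ?l) = sort ?l" by (rule sorted_list_of_multiset_mset)
  also have "sort ?l = rev ?l"
    by (rule properties_for_sort) (auto simp: sorted_iff_nth_mono rev_nth intro: decr)
  finally have "singular_values A = ?l" by simp
  then show ?thesis unfolding singular_value_def using i n_def by (cases i) (auto simp del: upt_Suc)
qed

text \<open>A QR factorization need not be unique, so it is a relation: \<open>Q\<close> and \<open>R\<close> are the
  factors of some reduced QR factorization of \<open>M\<close>.\<close>

definition reduced_qr :: "real Matrix.mat \<Rightarrow> real Matrix.mat \<Rightarrow> real Matrix.mat \<Rightarrow> bool" where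
  "reduced_qr M Q R \<longleftrightarrow>
     Q \<in> carrier_mat (dim_row M) (dim_col M) \<and> Q\<^sup>T * Q = 1\<^sub>m (dim_col M) \<and>
     R \<in> carrier_mat (dim_col M) (dim_col M) \<and> upper_triangular R \<and>
     M = Q * R"

definition rand_qlp ::
  "real Matrix.mat \<Rightarrow> real Matrix.mat \<Rightarrow> real Matrix.mat \<Rightarrow> real Matrix.mat \<Rightarrow> real Matrix.mat \<Rightarrow> bool" where
  "rand_qlp A \<Omega> Q L P \<longleftrightarrow> (\<exists>Qb Rb Rh R.
     reduced_qr (A\<^sup>T * \<Omega>) Qb Rb \<and>
     reduced_qr (A * Qb) Q Rh \<and>
     reduced_qr (A\<^sup>T * Q) P R \<and>
     L = R\<^sup>T)"

definition std_gaussian_matrix ::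
  "'w measure \<Rightarrow> nat \<Rightarrow> nat \<Rightarrow> ('w \<Rightarrow> real Matrix.mat) \<Rightarrow> bool" where
  "std_gaussian_matrix \<M> m n \<Omega> \<longleftrightarrow>
     prob_space \<M> \<and>
     (\<forall>\<omega> \<in> space \<M>. \<Omega> \<omega> \<in> carrier_mat m n) \<and>
     prob_space.indep_vars \<M> (\<lambda>_. borel) (\<lambda>ij \<omega>. \<Omega> \<omega> $$ ij) ({..<m} \<times> {..<n}) \<and>
     (\<forall>ij \<in> {..<m} \<times> {..<n}. distributed \<M> lborel (\<lambda>\<omega>. \<Omega> \<omega> $$ ij) std_normal_density)"

end

theory Submission
  imports Defs
begin

text \<open>Put \<open>W = U\<^sup>T \<Omega>\<^sub>1\<close>. Since \<open>A\<^sup>T \<Omega>\<^sub>1 = V \<Sigma> W\<close> and an unpivoted QR factorization keeps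
  the span of the leading columns, the first \<open>k\<close> columns of the three orthogonal factors \<open>Qb\<close>, \<open>Q\<close> and \<open>P\<close> span the ranges of
  \<open>V \<Sigma> W\<close>, \<open>U \<Sigma>\<^sup>2 W\<close> and \<open>V \<Sigma>\<^sup>3 W\<close>. In singular coordinates the range of \<open>\<Sigma>\<^sup>j W\<close> is a graph over
  the first \<open>k\<close> coordinates of slope at most \<open>f = \<psi>\<^sup>j \<nu>\<close>, where \<open>\<nu>\<close> is the spectral norm of
  \<open>W\<^sub>2 W\<^sub>1\<^sup>-\<^sup>1\<close>, and such a graph has distance at most \<open>f / sqrt (1 + f\<^sup>2) \<le> f\<close> from the coordinate
  subspace. The complementary subspaces have the same distance as soon as \<open>U U\<^sup>T = Q Q\<^sup>T\<close>.
  Almost sure invertibility of \<open>W\<^sub>1\<close> holds because \<open>det W\<^sub>1\<close> is a nonzero polynomial in the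
  entries of \<open>\<Omega>\<close>.\<close>

unbundle no vec_syntax
unbundle no inner_syntax

section \<open>Zeros of polynomials in independent Gaussians\<close>

text \<open>Only polynomial dependence on each variable separately is asked for, with coefficients
  that may depend in any way on the other variables. This passes through sums and products, and it
  is all that an induction over the coordinates by Fubini consumes.\<close>

definition coordinatewise_poly :: "(('i \<Rightarrow> real) \<Rightarrow> real) \<Rightarrow> bool" where
  "coordinatewise_poly f \<longleftrightarrow> (\<forall>x i. \<exists>p. \<forall>t. f (x(i := t)) = poly p t)"

lemma coordinatewise_poly_const: "coordinatewise_poly (\<lambda>x. c)"
  unfolding coordinatewise_poly_def by (intro allI exI[of _ "[:c:]"]) simp

lemma coordinatewise_poly_coord: "coordinatewise_poly (\<lambda>x. x j)"
  unfolding coordinatewise_poly_def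
proof (intro allI)
  fix x :: "'a \<Rightarrow> real" and i
  show "\<exists>p. \<forall>t. (x(i := t)) j = poly p t"
    by (rule exI[of _ "if j = i then [:0, 1:] else [:x j:]"]) simp
qed

lemma coordinatewise_poly_add:
  assumes "coordinatewise_poly f" "coordinatewise_poly g"
  shows "coordinatewise_poly (\<lambda>x. f x + g x)"
  using assms unfolding coordinatewise_poly_def by (metis poly_add)

lemma coordinatewise_poly_mult:
  assumes "coordinatewise_poly f" "coordinatewise_poly g"
  shows "coordinatewise_poly (\<lambda>x. f x * g x)"
  using assms unfolding coordinatewise_poly_def by (metis poly_mult)

lemma coordinatewise_poly_sum:
  assumes "\<And>a. a \<in> S \<Longrightarrow> coordinatewise_poly (f a)"
  shows "coordinatewise_poly (\<lambda>x. \<Sum>a\<in>S. f a x)"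
  using assms
  by (induction S rule: infinite_finite_induct)
    (auto intro: coordinatewise_poly_add simp: coordinatewise_poly_const)

lemma coordinatewise_poly_prod:
  assumes "\<And>a. a \<in> S \<Longrightarrow> coordinatewise_poly (f a)"
  shows "coordinatewise_poly (\<lambda>x. \<Prod>a\<in>S. f a x)"
  using assms
  by (induction S rule: infinite_finite_induct)
    (auto intro: coordinatewise_poly_mult simp: coordinatewise_poly_const)

text \<open>By Fubini: almost every choice of the other coordinates leaves a nonzero polynomial in the
  last one, whose finitely many roots form a null set.\<close>

lemma AE_coordinatewise_poly_nonzero:
  fixes N :: "'i \<Rightarrow> real measure"
  assumes "finite I" and prob: "\<And>i. prob_space (N i)" and sets: "\<And>i. sets (N i) = sets borel"
    and null: "\<And>i t. AE s in N i. s \<noteq> t"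
    and "coordinatewise_poly f" and "f \<in> borel_measurable (Pi\<^sub>M I N)"
    and "x0 \<in> extensional I" and "f x0 \<noteq> 0"
  shows "AE x in Pi\<^sub>M I N. f x \<noteq> 0"
  using assms(1,5-)
proof (induction I arbitrary: f x0 rule: finite_induct)
  case empty
  \<comment> \<open>\<open>extensional {}\<close> forces \<open>x0\<close> to be the only point of
    the empty product, so \<open>f x0 \<noteq> 0\<close> is already the claim.\<close>
  then show ?case by (auto simp: PiM_empty AE_count_space)
next
  case (insert i I)
  have sp: "space (N j) = UNIV" for j using sets_eq_imp_space_eq[OF sets] by simp
  interpret product_sigma_finite N
    by (intro product_sigma_finite.intro prob_space_imp_sigma_finite prob)
  note [measurable] = insert.prems(2)
  have upd1 [measurable]: "(\<lambda>y. y(i := t)) \<in> Pi\<^sub>M I N \<rightarrow>\<^sub>M Pi\<^sub>M (insert i I) N" for t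
    by (rule measurable_fun_upd[where J = I]) (auto simp: sp)
  \<comment> \<open>Freezing the new coordinate at its value in the witness \<open>x0\<close> keeps
    a point where the function is nonzero, so the induction hypothesis applies to
    \<open>g\<close>.\<close>
  define g where "g y = f (y(i := x0 i))" for y
  have "AE y in Pi\<^sub>M I N. g y \<noteq> 0"
  proof (rule insert.IH)
    show "coordinatewise_poly g"
      unfolding coordinatewise_poly_def
    proof (intro allI)
      fix x j
      show "\<exists>p. \<forall>t. g (x(j := t)) = poly p t"
      proof (cases "j = i")
        case True
        then show ?thesis by (intro exI[of _ "[:g x:]"]) (simp add: g_def)
      next
        case False
        show ?thesis
          using insert.prems(1) unfolding g_def fun_upd_twist[OF False] coordinatewise_poly_def
          by blast
      qed
    qed
    show "g \<in> borel_measurable (Pi\<^sub>M I N)" unfolding g_def by measurable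
    \<comment> \<open>Off its index set an extensional function takes the value
      \<open>undefined\<close>. Since \<open>g\<close> overwrites coordinate \<open>i\<close>, its
      value at this new witness is still \<open>f x0\<close>.\<close>
    show "x0(i := undefined) \<in> extensional I" using insert.prems(3) by (auto simp: extensional_def)
    show "g (x0(i := undefined)) \<noteq> 0" using insert.prems(4) by (simp add: g_def)
  qed
  then have "AE y in Pi\<^sub>M I N. AE t in N i. f (y(i := t)) \<noteq> 0"
  proof eventually_elim
    case (elim y)
    obtain p where p: "f (y(i := t)) = poly p t" for t
      using insert.prems(1) unfolding coordinatewise_poly_def by blast
    \<comment> \<open>\<open>g y \<noteq> 0\<close> says that \<open>p\<close> does not vanish at
      \<open>x0 i\<close>.\<close>
    then have "p \<noteq> 0" using elim by (auto simp: g_def)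
    then have "finite {t. poly p t = 0}" by (rule poly_roots_finite)
    then have "AE t in N i. \<forall>s\<in>{t. poly p t = 0}. t \<noteq> s"
      using null by (intro AE_finite_allI)
    then show ?case by eventually_elim (auto simp: p)
  qed
  \<comment> \<open>The nested almost-everywhere claim is recast as a vanishing iterated integral of
    the indicator of the zero set, the form that Tonelli's theorem turns into an integral over the
    larger product.\<close>
  then have inner: "AE y in Pi\<^sub>M I N. (\<integral>\<^sup>+t. indicator {0::real} (f (y(i := t))) \<partial>N i) = (0::ennreal)"
  proof eventually_elim
    case (elim y)
    then have "AE t in N i. indicator {0::real} (f (y(i := t))) = (0::ennreal)"
      by eventually_elim simp
    from nn_integral_cong_AE[OF this] show ?case by simp
  qed
  have "(\<integral>\<^sup>+x. indicator {0::real} (f x) \<partial>Pi\<^sub>M (insert i I) N)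
      = (\<integral>\<^sup>+y. \<integral>\<^sup>+t. indicator {0::real} (f (y(i := t))) \<partial>N i \<partial>Pi\<^sub>M I N)"
    using insert.hyps by (rule product_nn_integral_insert) measurable
  also have "\<dots> = 0"
    using nn_integral_cong_AE[OF inner] by simp
  finally have "AE x in Pi\<^sub>M (insert i I) N. indicator {0::real} (f x) = (0::ennreal)"
    by (subst (asm) nn_integral_0_iff_AE) measurable
  then show ?case by eventually_elim (simp add: indicator_def split: if_splits)
qed

lemma AE_gaussian_coordinatewise_poly_nonzero:
  assumes \<Omega>: "std_gaussian_matrix \<M> m n \<Omega>" and mn: "0 < m" "0 < n"
    and f: "coordinatewise_poly f" "f \<in> borel_measurable (Pi\<^sub>M ({..<m} \<times> {..<n}) (\<lambda>_. borel))"
    and x0: "x0 \<in> extensional ({..<m} \<times> {..<n})" "f x0 \<noteq> 0"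
  shows "AE \<omega> in \<M>. f (\<lambda>ij\<in>{..<m} \<times> {..<n}. \<Omega> \<omega> $$ ij) \<noteq> 0"
proof -
  let ?I = "{..<m} \<times> {..<n}"
  let ?X = "\<lambda>ij \<omega>. \<Omega> \<omega> $$ ij"
  define G where "G = density lborel (\<lambda>x. ennreal (std_normal_density x))"
  interpret prob_space \<M> using \<Omega> by (simp add: std_gaussian_matrix_def)
  have d: "distributed \<M> lborel (?X ij) std_normal_density" if "ij \<in> ?I" for ij
    using \<Omega> that unfolding std_gaussian_matrix_def by blast
  then have [measurable]: "?X ij \<in> borel_measurable \<M>" if "ij \<in> ?I" for ij
    using that distributed_measurable[OF d[OF that]] by simp
  \<comment> \<open>Independence makes the joint law of the entries the product of their laws;
    \<open>mn\<close> keeps the index set nonempty, as this characterization of independence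
    requires.\<close>
  have "distr \<M> (Pi\<^sub>M ?I (\<lambda>_. borel)) (\<lambda>\<omega>. \<lambda>ij\<in>?I. ?X ij \<omega>) = Pi\<^sub>M ?I (\<lambda>ij. distr \<M> borel (?X ij))"
    using \<Omega> mn by (subst indep_vars_iff_distr_eq_PiM'[symmetric]) (auto simp: std_gaussian_matrix_def)
  also have "\<dots> = Pi\<^sub>M ?I (\<lambda>_. G)"
  proof (rule PiM_cong[OF refl])
    fix ij assume "ij \<in> ?I"
    then show "distr \<M> borel (?X ij) = G"
      using distributed_distr_eq_density[OF d] by (simp add: G_def cong: distr_cong)
  qed
  finally have distr: "distr \<M> (Pi\<^sub>M ?I (\<lambda>_. borel)) (\<lambda>\<omega>. \<lambda>ij\<in>?I. ?X ij \<omega>) = Pi\<^sub>M ?I (\<lambda>_. G)" .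
  have G: "prob_space G" unfolding G_def by (rule prob_space_normal_density) simp
  have sG: "sets G = sets borel" by (simp add: G_def)
  have "AE x in Pi\<^sub>M ?I (\<lambda>_. G). f x \<noteq> 0"
  proof (rule AE_coordinatewise_poly_nonzero[OF _ G sG _ f(1) _ x0])
    show "AE s in G. s \<noteq> t" for t
      unfolding G_def using AE_lborel_singleton[of t] by (subst AE_density) auto
    show "f \<in> borel_measurable (Pi\<^sub>M ?I (\<lambda>_. G))"
      using f(2) measurable_cong_sets[OF sets_PiM_cong[OF refl sG] refl, of ?I] by blast
  qed simp
  then show ?thesis unfolding distr[symmetric]
    using f(2) by (subst (asm) AE_distr_iff) measurable
qed


section \<open>Determinants and the leading Gaussian block\<close>

lemma coordinatewise_poly_det:
  assumes "\<And>i j. i < k \<Longrightarrow> j < k \<Longrightarrow> coordinatewise_poly (h i j)"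
  shows "coordinatewise_poly (\<lambda>x. det (Matrix.mat k k (\<lambda>(i, j). h i j x)))"
proof -
  have "coordinatewise_poly (\<lambda>x. \<Sum>p\<in>{p. p permutes {0..<k}}.
      signof p * (\<Prod>i = 0..<k. h i (p i) x))"
    using assms permutes_in_image
    by (intro coordinatewise_poly_sum coordinatewise_poly_mult coordinatewise_poly_prod
        coordinatewise_poly_const) fastforce
  also have "(\<lambda>x. \<Sum>p\<in>{p. p permutes {0..<k}}. signof p * (\<Prod>i = 0..<k. h i (p i) x))
      = (\<lambda>x. det (Matrix.mat k k (\<lambda>(i, j). h i j x)))"
    by (intro ext, subst det_def'[of _ k]) (auto intro!: sum.cong prod.cong)
  finally show ?thesis .
qed

lemma borel_measurable_det:
  assumes "\<And>i j. i < k \<Longrightarrow> j < k \<Longrightarrow> h i j \<in> borel_measurable M"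
  shows "(\<lambda>x. det (Matrix.mat k k (\<lambda>(i, j). h i j x)) :: real) \<in> borel_measurable M"
proof -
  have "(\<lambda>x. \<Sum>p\<in>{p. p permutes {0..<k}}. signof p * (\<Prod>i = 0..<k. h i (p i) x)) \<in> borel_measurable M"
    using assms permutes_in_image
    by (intro borel_measurable_sum borel_measurable_times borel_measurable_prod
        borel_measurable_const) fastforce
  also have "(\<lambda>x. \<Sum>p\<in>{p. p permutes {0..<k}}. signof p * (\<Prod>i = 0..<k. h i (p i) x))
      = (\<lambda>x. det (Matrix.mat k k (\<lambda>(i, j). h i j x)))"
    by (intro ext, subst det_def'[of _ k]) (auto intro!: sum.cong prod.cong)
  finally show ?thesis .
qed

lemma invertible_mat_iff_det:
  fixes M :: "'a :: field Matrix.mat"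
  assumes M: "M \<in> carrier_mat n n"
  shows "invertible_mat M \<longleftrightarrow> det M \<noteq> 0"
proof
  assume "invertible_mat M"
  then obtain B where B: "M * B = 1\<^sub>m n" "B * M = 1\<^sub>m (dim_row B)"
    using M unfolding invertible_mat_def inverts_mat_def by auto
  have "B \<in> carrier_mat n n"
    using arg_cong[OF B(1), of dim_col] arg_cong[OF B(2), of dim_col] M by auto
  from det_mult[OF M this] have "det M * det B = 1" using B(1) by simp
  then show "det M \<noteq> 0" by auto
next
  assume "det M \<noteq> 0"
  from det_non_zero_imp_unit[OF M this]
  obtain B where "B \<in> carrier_mat n n" "B * M = 1\<^sub>m n" "M * B = 1\<^sub>m n"
    unfolding Units_def by (auto simp: ring_mat_def)
  then show "invertible_mat M"
    unfolding invertible_mat_def inverts_mat_def using M by (auto simp: square_mat.simps)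
qed

lemma AE_invertible_gaussian_block:
  assumes \<Omega>: "std_gaussian_matrix \<M> m n \<Omega>" and k: "1 \<le> k" "k \<le> n" and nm: "n \<le> m"
    and U: "U \<in> carrier_mat m n" "U\<^sup>T * U = 1\<^sub>m n"
  shows "AE \<omega> in \<M>. invertible_mat (top_rows k (U\<^sup>T * left_cols k (\<Omega> \<omega>)))"
proof -
  let ?I = "{..<m} \<times> {..<n}"
  define h where "h i j x = (\<Sum>l<m. U $$ (l, i) * x (l, j))" for i j and x :: "nat \<times> nat \<Rightarrow> real"
  define f where "f x = det (Matrix.mat k k (\<lambda>(i, j). h i j x))" for x
  \<comment> \<open>The witness puts \<open>U\<close> in place of the random matrix: the block
    becomes the leading part of \<open>U\<^sup>T * U = 1\<^sub>m n\<close>, an identity matrix with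
    determinant 1.\<close>
  define x0 where "x0 = (\<lambda>ij\<in>?I. U $$ ij)"
  have "AE \<omega> in \<M>. f (\<lambda>ij\<in>?I. \<Omega> \<omega> $$ ij) \<noteq> 0"
  proof (rule AE_gaussian_coordinatewise_poly_nonzero[OF \<Omega>])
    show "coordinatewise_poly f"
      unfolding f_def h_def
      by (intro coordinatewise_poly_det coordinatewise_poly_sum coordinatewise_poly_mult
          coordinatewise_poly_const coordinatewise_poly_coord)
    show "f \<in> borel_measurable (Pi\<^sub>M ?I (\<lambda>_. borel))"
      unfolding f_def h_def using k(2)
      by (intro borel_measurable_det borel_measurable_sum borel_measurable_times
          borel_measurable_const measurable_component_singleton) auto
    show "x0 \<in> extensional ?I" by (simp add: x0_def)
    have "h i j x0 = 1\<^sub>m k $$ (i, j)" if "i < k" "j < k" for i j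
    proof -
      have "h i j x0 = (U\<^sup>T * U) $$ (i, j)"
        using that k(2) U(1)
        by (auto simp: h_def x0_def scalar_prod_def atLeast0LessThan intro!: sum.cong)
      then show ?thesis using that k(2) U(2) by simp
    qed
    then have "Matrix.mat k k (\<lambda>(i, j). h i j x0) = 1\<^sub>m k" by (intro eq_matI) auto
    then show "f x0 \<noteq> 0" by (simp add: f_def)
  qed (use k nm in auto)
  then show ?thesis
  proof (rule AE_mp, intro AE_I2 impI)
    fix \<omega> assume \<omega>: "\<omega> \<in> space \<M>" and nz: "f (\<lambda>ij\<in>?I. \<Omega> \<omega> $$ ij) \<noteq> 0"
    have O: "\<Omega> \<omega> \<in> carrier_mat m n" using \<Omega> \<omega> unfolding std_gaussian_matrix_def by blast
    have "top_rows k (U\<^sup>T * left_cols k (\<Omega> \<omega>))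
        = Matrix.mat k k (\<lambda>(i, j). h i j (\<lambda>ij\<in>?I. \<Omega> \<omega> $$ ij))"
      using O U(1) k(2)
      by (intro eq_matI) (auto simp: top_rows_def left_cols_def h_def scalar_prod_def
          atLeast0LessThan intro!: sum.cong)
    then show "invertible_mat (top_rows k (U\<^sup>T * left_cols k (\<Omega> \<omega>)))"
      using nz by (subst invertible_mat_iff_det[of _ k]) (auto simp: f_def)
  qed
qed

section \<open>Spectral norm and orthogonal projectors\<close>

lemma scalar_prod_lessThan: "v \<bullet> w = (\<Sum>i<dim_vec w. v $ i * w $ i)"
  by (simp add: scalar_prod_def atLeast0LessThan)

lemma scalar_prod_self_nonneg: "0 \<le> (v :: real Matrix.vec) \<bullet> v"
  by (simp add: scalar_prod_lessThan sum_nonneg)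

lemma vec_norm2_nonneg: "0 \<le> vec_norm2 v"
  by (simp add: vec_norm2_def scalar_prod_self_nonneg)

lemma vec_norm2_square: "(vec_norm2 v)\<^sup>2 = v \<bullet> v"
  by (simp add: vec_norm2_def scalar_prod_self_nonneg)

lemma vec_norm2_le_iff:
  assumes "0 \<le> c"
  shows "vec_norm2 v \<le> c * vec_norm2 w \<longleftrightarrow> v \<bullet> v \<le> c\<^sup>2 * (w \<bullet> w)"
  using assms abs_le_square_iff[of "vec_norm2 v" "c * vec_norm2 w"]
  by (simp add: vec_norm2_nonneg power_mult_distrib vec_norm2_square)

lemma vec_norm2_smult: "vec_norm2 (c \<cdot>\<^sub>v v) = \<bar>c\<bar> * vec_norm2 v"
proof -
  have "(c \<cdot>\<^sub>v v) \<bullet> (c \<cdot>\<^sub>v v) = c\<^sup>2 * (v \<bullet> v)"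
    by (simp add: scalar_prod_lessThan sum_distrib_left power2_eq_square algebra_simps)
  then show ?thesis by (simp add: vec_norm2_def real_sqrt_mult)
qed

text \<open>Cauchy-Schwarz in each row gives the Frobenius norm as a constant. Such a crude bound
  shows that the set under the \<open>Sup\<close> of \<open>spectral_norm\<close> is bounded
  above.\<close>

lemma vec_norm2_mult_mat_vec_bound:
  obtains C where "0 \<le> C"
    "\<And>x. x \<in> carrier_vec (dim_col M) \<Longrightarrow> vec_norm2 (M *\<^sub>v x) \<le> C * vec_norm2 x"
proof -
  define S where "S = (\<Sum>i<dim_row M. Matrix.row M i \<bullet> Matrix.row M i)"
  have S: "0 \<le> S" by (simp add: S_def sum_nonneg scalar_prod_self_nonneg)
  have "vec_norm2 (M *\<^sub>v x) \<le> sqrt S * vec_norm2 x" if x: "x \<in> carrier_vec (dim_col M)" for x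
  proof -
    have "(M *\<^sub>v x) \<bullet> (M *\<^sub>v x) = (\<Sum>i<dim_row M. (Matrix.row M i \<bullet> x)\<^sup>2)"
      by (simp add: scalar_prod_lessThan[of "M *\<^sub>v x"] power2_eq_square)
    also have "\<dots> \<le> (\<Sum>i<dim_row M. (Matrix.row M i \<bullet> Matrix.row M i) * (x \<bullet> x))"
    proof (rule sum_mono)
      fix i
      show "(Matrix.row M i \<bullet> x)\<^sup>2 \<le> (Matrix.row M i \<bullet> Matrix.row M i) * (x \<bullet> x)"
        using Cauchy_Schwarz_ineq_sum[of "\<lambda>j. Matrix.row M i $ j" "\<lambda>j. x $ j" "{..<dim_vec x}"] x
        by (simp add: scalar_prod_lessThan power2_eq_square)
    qed
    finally show ?thesis
      using S by (subst vec_norm2_le_iff) (simp_all add: S_def sum_distrib_right)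
  qed
  then show ?thesis using S by (intro that[of "sqrt S"]) auto
qed

lemma vec_norm2_zero [simp]: "vec_norm2 (0\<^sub>v n) = 0"
  by (simp add: vec_norm2_def)

lemma spectral_norm_leI:
  assumes "0 \<le> c" "\<And>x. x \<in> carrier_vec (dim_col M) \<Longrightarrow> vec_norm2 (M *\<^sub>v x) \<le> c * vec_norm2 x"
  shows "spectral_norm M \<le> c"
  unfolding spectral_norm_def
proof (rule cSup_least)
  show "{vec_norm2 (M *\<^sub>v x) | x. x \<in> carrier_vec (dim_col M) \<and> vec_norm2 x \<le> 1} \<noteq> {}"
    by (auto intro!: exI[of _ "0\<^sub>v (dim_col M)"])
  fix y assume "y \<in> {vec_norm2 (M *\<^sub>v x) | x. x \<in> carrier_vec (dim_col M) \<and> vec_norm2 x \<le> 1}"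
  then obtain x where "x \<in> carrier_vec (dim_col M)" "vec_norm2 x \<le> 1" "y = vec_norm2 (M *\<^sub>v x)" by blast
  then show "y \<le> c"
    using assms(2)[of x] mult_left_mono[OF _ assms(1), of "vec_norm2 x" 1] by simp
qed

lemma vec_norm2_le_spectral_norm:
  assumes "x \<in> carrier_vec (dim_col M)" "vec_norm2 x \<le> 1"
  shows "vec_norm2 (M *\<^sub>v x) \<le> spectral_norm M"
  unfolding spectral_norm_def
proof (rule cSup_upper)
  obtain C where C: "0 \<le> C" "\<And>x. x \<in> carrier_vec (dim_col M) \<Longrightarrow> vec_norm2 (M *\<^sub>v x) \<le> C * vec_norm2 x"
    using vec_norm2_mult_mat_vec_bound[of M] by blast
  show "bdd_above {vec_norm2 (M *\<^sub>v x) | x. x \<in> carrier_vec (dim_col M) \<and> vec_norm2 x \<le> 1}"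
  proof (rule bdd_aboveI[of _ C])
    fix y assume "y \<in> {vec_norm2 (M *\<^sub>v x) | x. x \<in> carrier_vec (dim_col M) \<and> vec_norm2 x \<le> 1}"
    then obtain x where "x \<in> carrier_vec (dim_col M)" "vec_norm2 x \<le> 1" "y = vec_norm2 (M *\<^sub>v x)" by blast
    then show "y \<le> C"
      using C(2)[of x] mult_left_mono[OF _ C(1), of "vec_norm2 x" 1] by simp
  qed
qed (use assms in blast)

lemma spectral_norm_nonneg: "0 \<le> spectral_norm M"
  by (rule order_trans[OF vec_norm2_nonneg vec_norm2_le_spectral_norm[of "0\<^sub>v (dim_col M)"]]) auto

lemma vec_norm2_mult_mat_vec_le:
  assumes x: "x \<in> carrier_vec (dim_col M)"
  shows "vec_norm2 (M *\<^sub>v x) \<le> spectral_norm M * vec_norm2 x"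
proof (cases "vec_norm2 x = 0")
  case True
  \<comment> \<open>A vector of norm zero cannot be normalised; the crude bound shows directly that
    its image has norm zero.\<close>
  obtain C where "vec_norm2 (M *\<^sub>v x) \<le> C * vec_norm2 x"
    using vec_norm2_mult_mat_vec_bound[of M] x by blast
  then show ?thesis using True by simp
next
  case False
  then have pos: "vec_norm2 x > 0" using vec_norm2_nonneg[of x] by simp
  have "vec_norm2 (M *\<^sub>v ((1 / vec_norm2 x) \<cdot>\<^sub>v x)) \<le> spectral_norm M"
    using x pos by (intro vec_norm2_le_spectral_norm) (auto simp: vec_norm2_smult)
  then have "vec_norm2 (M *\<^sub>v x) / vec_norm2 x \<le> spectral_norm M"
    using x pos mult_mat_vec[of M "dim_row M" "dim_col M" x "1 / vec_norm2 x"]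
    by (simp add: vec_norm2_smult)
  then show ?thesis using pos by (simp add: divide_le_eq)
qed

lemma range_mat_eq:
  assumes "M \<in> carrier_mat d r"
  shows "range_mat M = (\<lambda>x. M *\<^sub>v x) ` carrier_vec r"
proof -
  interpret vec_space "TYPE(real)" d .
  show ?thesis using col_space_eq[OF assms] assms by auto
qed

section \<open>Matrices with orthonormal columns and their projections\<close>

lemma isometry_transpose_mult:
  fixes B :: "real Matrix.mat"
  assumes "B \<in> carrier_mat d r" "B\<^sup>T * B = 1\<^sub>m r" "u \<in> carrier_vec r"
  shows "B\<^sup>T *\<^sub>v (B *\<^sub>v u) = u"
  using assms assoc_mult_mat_vec[of "B\<^sup>T" r d B r u] by simp

lemma isometry_scalar_prod:
  fixes B :: "real Matrix.mat"
  assumes B: "B \<in> carrier_mat d r" "B\<^sup>T * B = 1\<^sub>m r" and "u \<in> carrier_vec r" "v \<in> carrier_vec r"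
  shows "(B *\<^sub>v u) \<bullet> (B *\<^sub>v v) = u \<bullet> v"
  using transpose_vec_mult_scalar[OF B(1) assms(4), of "B *\<^sub>v u"] isometry_transpose_mult[OF B assms(3)]
    mult_mat_vec_carrier[OF B(1) assms(3)]
  by simp

lemma scalar_prod_self_minus:
  fixes v w :: "real Matrix.vec"
  assumes "v \<in> carrier_vec d" "w \<in> carrier_vec d"
  shows "(v - w) \<bullet> (v - w) = v \<bullet> v - 2 * (v \<bullet> w) + w \<bullet> w"
proof -
  have "(v - w) \<bullet> (v - w) = (\<Sum>i<d. v $ i * v $ i - 2 * (v $ i * w $ i) + w $ i * w $ i)"
    using assms by (auto simp: scalar_prod_lessThan algebra_simps intro!: sum.cong)
  then show ?thesis
    using assms by (simp add: scalar_prod_lessThan sum.distrib sum_subtractf sum_distrib_left)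
qed

lemma minus_minus_vec:
  fixes p l y :: "'a :: ab_group_add Matrix.vec"
  assumes "p \<in> carrier_vec d" "l \<in> carrier_vec d" "y \<in> carrier_vec d"
  shows "p + l - y = p - (y - l)"
  using assms by (intro eq_vecI) auto

text \<open>Pythagoras: the projection \<open>B *\<^sub>v (B\<^sup>T *\<^sub>v x)\<close> has the
  norm of its coordinate vector and is orthogonal to the residual.\<close>

lemma projection_residual_norm:
  fixes B :: "real Matrix.mat"
  assumes B: "B \<in> carrier_mat d r" "B\<^sup>T * B = 1\<^sub>m r" and x: "x \<in> carrier_vec d"
  shows "(x - B *\<^sub>v (B\<^sup>T *\<^sub>v x)) \<bullet> (x - B *\<^sub>v (B\<^sup>T *\<^sub>v x))
    = x \<bullet> x - (B\<^sup>T *\<^sub>v x) \<bullet> (B\<^sup>T *\<^sub>v x)"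
proof -
  have c: "B\<^sup>T *\<^sub>v x \<in> carrier_vec r" "B *\<^sub>v (B\<^sup>T *\<^sub>v x) \<in> carrier_vec d" using B x by auto
  show ?thesis
    unfolding scalar_prod_self_minus[OF x c(2)]
    using isometry_scalar_prod[OF B c(1) c(1)] transpose_vec_mult_scalar[OF B(1) c(1) x] by simp
qed

lemma bessel_inequality:
  fixes B :: "real Matrix.mat"
  assumes B: "B \<in> carrier_mat d r" "B\<^sup>T * B = 1\<^sub>m r" and x: "x \<in> carrier_vec d"
  shows "(B\<^sup>T *\<^sub>v x) \<bullet> (B\<^sup>T *\<^sub>v x) \<le> x \<bullet> x"
  using projection_residual_norm[OF assms] scalar_prod_self_nonneg by (metis diff_ge_0_iff_ge)

section \<open>Column and row blocks\<close>

lemma left_cols_carrier: "M \<in> carrier_mat r c \<Longrightarrow> left_cols k M \<in> carrier_mat r k"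
  and right_cols_carrier: "M \<in> carrier_mat r c \<Longrightarrow> right_cols k M \<in> carrier_mat r (c - k)"
  and top_rows_carrier: "M \<in> carrier_mat r c \<Longrightarrow> top_rows k M \<in> carrier_mat k c"
  and bottom_rows_carrier: "M \<in> carrier_mat r c \<Longrightarrow> bottom_rows k M \<in> carrier_mat (r - k) c"
  by (auto simp: left_cols_def right_cols_def top_rows_def bottom_rows_def)

lemma left_cols_mult:
  assumes "A \<in> carrier_mat r s" "M \<in> carrier_mat s c" "k \<le> c"
  shows "left_cols k (A * M) = A * left_cols k M"
  using assms by (intro eq_matI) (auto simp: left_cols_def scalar_prod_def)

lemma left_cols_all: "M \<in> carrier_mat r c \<Longrightarrow> left_cols c M = M"
  by (intro eq_matI) (auto simp: left_cols_def)

lemma left_cols_isometry: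
  fixes U :: "real Matrix.mat"
  assumes U: "U \<in> carrier_mat d n" "U\<^sup>T * U = 1\<^sub>m n" and k: "k \<le> n"
  shows "(left_cols k U)\<^sup>T * left_cols k U = 1\<^sub>m k"
proof (rule eq_matI)
  fix i j assume "i < dim_row (1\<^sub>m k :: real Matrix.mat)" "j < dim_col (1\<^sub>m k :: real Matrix.mat)"
  then have "((left_cols k U)\<^sup>T * left_cols k U) $$ (i, j) = (U\<^sup>T * U) $$ (i, j)"
    using U(1) k by (auto simp: left_cols_def scalar_prod_def)
  also have "\<dots> = 1\<^sub>m n $$ (i, j)" using U(2) by simp
  finally show "((left_cols k U)\<^sup>T * left_cols k U) $$ (i, j) = 1\<^sub>m k $$ (i, j)"
    using \<open>i < _\<close> \<open>j < _\<close> k by simp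
qed (auto simp: left_cols_def)

lemma right_cols_isometry:
  fixes U :: "real Matrix.mat"
  assumes U: "U \<in> carrier_mat d n" "U\<^sup>T * U = 1\<^sub>m n" and k: "k \<le> n"
  shows "(right_cols k U)\<^sup>T * right_cols k U = 1\<^sub>m (n - k)"
proof (rule eq_matI)
  fix i j assume "i < dim_row (1\<^sub>m (n - k) :: real Matrix.mat)" "j < dim_col (1\<^sub>m (n - k) :: real Matrix.mat)"
  then have "((right_cols k U)\<^sup>T * right_cols k U) $$ (i, j) = (U\<^sup>T * U) $$ (i + k, j + k)"
    using U(1) k by (auto simp: right_cols_def scalar_prod_def)
  also have "\<dots> = 1\<^sub>m n $$ (i + k, j + k)" using U(2) by simp
  finally show "((right_cols k U)\<^sup>T * right_cols k U) $$ (i, j) = 1\<^sub>m (n - k) $$ (i, j)"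
    using \<open>i < _\<close> \<open>j < _\<close> k by simp
qed (use U in \<open>auto simp: right_cols_def\<close>)

lemma left_cols_transpose_mult_vec:
  assumes "U \<in> carrier_mat d n" "x \<in> carrier_vec d" "k \<le> n"
  shows "(left_cols k U)\<^sup>T *\<^sub>v x = Matrix.vec k (\<lambda>i. (U\<^sup>T *\<^sub>v x) $ i)"
  using assms by (intro eq_vecI) (auto simp: left_cols_def scalar_prod_def)

lemma sum_lessThan_split:
  fixes g :: "nat \<Rightarrow> 'a :: comm_monoid_add"
  assumes "k \<le> n"
  shows "sum g {..<n} = sum g {..<k} + sum g {k..<n}"
  using sum.atLeastLessThan_concat[of 0 k n g] assms by (simp add: atLeast0LessThan)

lemma scalar_prod_split:
  fixes v :: "real Matrix.vec"
  assumes "v \<in> carrier_vec n" "w \<in> carrier_vec n" "k \<le> n"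
  shows "v \<bullet> w = (\<Sum>i<k. v $ i * w $ i) + (\<Sum>i\<in>{k..<n}. v $ i * w $ i)"
  using assms by (simp add: scalar_prod_lessThan sum_lessThan_split[OF assms(3)])

text \<open>The range of \<open>B\<close> is, in the coordinates of the orthonormal columns of \<open>U\<close>, a graph over
  the first \<open>k\<close> coordinates of slope at most \<open>f\<close>. With \<open>\<Pi>\<^sub>1, \<Pi>\<^sub>2\<close> the two projectors,
  \<open>(\<Pi>\<^sub>1 - \<Pi>\<^sub>2) x = \<Pi>\<^sub>1 (x - \<Pi>\<^sub>2 x) - (\<Pi>\<^sub>2 x - \<Pi>\<^sub>1 \<Pi>\<^sub>2 x)\<close> is an orthogonal decomposition whose
  parts are bounded by \<open>f / sqrt (1 + f\<^sup>2)\<close> times \<open>x - \<Pi>\<^sub>2 x\<close> and \<open>\<Pi>\<^sub>2 x\<close>.\<close>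

lemma subspace_dist_graph_le:
  fixes U B :: "real Matrix.mat" and H :: "real Matrix.vec set"
  assumes U: "U \<in> carrier_mat d n" "U\<^sup>T * U = 1\<^sub>m n" and k: "k \<le> n"
    and B: "B \<in> carrier_mat d r" "B\<^sup>T * B = 1\<^sub>m r"
    and H: "H \<subseteq> carrier_vec n" and ran: "range_mat B = (\<lambda>h. U *\<^sub>v h) ` H" and f: "0 \<le> f"
    and slope: "\<And>h. h \<in> H \<Longrightarrow> (\<Sum>i\<in>{k..<n}. h $ i * h $ i) \<le> f\<^sup>2 * (\<Sum>i<k. h $ i * h $ i)"
    and onto: "\<And>c. c \<in> carrier_vec n \<Longrightarrow> \<exists>h\<in>H. \<forall>i<k. h $ i = c $ i"
  shows "subspace_dist d (range_mat (left_cols k U)) (range_mat B) \<le> f / sqrt (1 + f\<^sup>2)"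
proof -
  define L where "L = left_cols k U"
  have L: "L \<in> carrier_mat d k" "L\<^sup>T * L = 1\<^sub>m k"
    using left_cols_carrier[OF U(1)] left_cols_isometry[OF U k] by (auto simp: L_def)
  \<comment> \<open>\<open>f\<close> bounds the tangent of the largest angle and \<open>c\<close> is
    the corresponding sine.\<close>
  define c where "c = f / sqrt (1 + f\<^sup>2)"
  have c: "0 \<le> c" "c\<^sup>2 * (1 + f\<^sup>2) = f\<^sup>2"
    using f add_pos_nonneg[of 1 "f\<^sup>2"] by (auto simp: c_def power_divide)
  \<comment> \<open>Turns a tangent bound into a sine bound: a part that is at most
    \<open>f\<^sup>2\<close> times the rest is at most \<open>c\<^sup>2\<close> times the
    whole.\<close>
  have scale: "a \<le> c\<^sup>2 * (b + a)" if "a \<le> f\<^sup>2 * b" for a b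
  proof -
    have "(1 + f\<^sup>2) * a \<le> (1 + f\<^sup>2) * (c\<^sup>2 * (b + a))"
    proof -
      have "(1 + f\<^sup>2) * (c\<^sup>2 * (b + a)) = f\<^sup>2 * (b + a)"
        using c(2) by (metis mult.assoc mult.commute)
      then show ?thesis using that by (simp add: distrib_left distrib_right)
    qed
    then show ?thesis by (simp add: mult_le_cancel_left add_pos_nonneg)
  qed
  have Lx: "(L\<^sup>T *\<^sub>v x) \<bullet> (L\<^sup>T *\<^sub>v x) = (\<Sum>i<k. (U\<^sup>T *\<^sub>v x) $ i * (U\<^sup>T *\<^sub>v x) $ i)"
    if "x \<in> carrier_vec d" for x
    using left_cols_transpose_mult_vec[OF U(1) that k] by (simp add: L_def scalar_prod_lessThan)
  have bound: "vec_norm2 ((L * L\<^sup>T - B * B\<^sup>T) *\<^sub>v x) \<le> c * vec_norm2 x" if x: "x \<in> carrier_vec d" for x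
  proof -
    define y where "y = B *\<^sub>v (B\<^sup>T *\<^sub>v x)"
    define w where "w = x - y"
    have cy: "B\<^sup>T *\<^sub>v x \<in> carrier_vec r" "y \<in> carrier_vec d" "w \<in> carrier_vec d"
      using B(1) x by (auto simp: y_def w_def)
    have yy: "y \<bullet> y = (B\<^sup>T *\<^sub>v x) \<bullet> (B\<^sup>T *\<^sub>v x)"
      unfolding y_def by (rule isometry_scalar_prod[OF B cy(1) cy(1)])
    have ww: "w \<bullet> w = x \<bullet> x - y \<bullet> y"
      unfolding yy unfolding w_def y_def by (rule projection_residual_norm[OF B x])
    define p where "p = L *\<^sub>v (L\<^sup>T *\<^sub>v w)"
    define q where "q = y - L *\<^sub>v (L\<^sup>T *\<^sub>v y)"
    have cL: "L\<^sup>T *\<^sub>v w \<in> carrier_vec k" "L\<^sup>T *\<^sub>v y \<in> carrier_vec k"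
      "p \<in> carrier_vec d" "q \<in> carrier_vec d" "L *\<^sub>v (L\<^sup>T *\<^sub>v y) \<in> carrier_vec d"
      using L(1) cy by (auto simp: p_def q_def)
    have "(L * L\<^sup>T - B * B\<^sup>T) *\<^sub>v x = p - q"
    proof -
      have "(L * L\<^sup>T - B * B\<^sup>T) *\<^sub>v x = L *\<^sub>v (L\<^sup>T *\<^sub>v x) - y"
        using L(1) B(1) x
        by (simp add: minus_mult_distrib_mat_vec[of _ d d] y_def assoc_mult_mat_vec[of _ d _ _ d])
      moreover have "L *\<^sub>v (L\<^sup>T *\<^sub>v x) = p + L *\<^sub>v (L\<^sup>T *\<^sub>v y)"
      proof -
        have "x = w + y" using x cy by (intro eq_vecI) (auto simp: w_def)
        then show ?thesis
          using L(1) cy cL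
          by (simp add: p_def mult_add_distrib_mat_vec[of _ k d] mult_add_distrib_mat_vec[of _ d k])
      qed
      ultimately show ?thesis
        using minus_minus_vec[OF cL(3) cL(5) cy(2)] by (simp add: q_def)
    qed
    moreover have "p \<bullet> q = 0"
    proof -
      have "L\<^sup>T *\<^sub>v q = L\<^sup>T *\<^sub>v y - L\<^sup>T *\<^sub>v (L *\<^sub>v (L\<^sup>T *\<^sub>v y))"
        unfolding q_def using L(1) cy cL by (intro mult_minus_distrib_mat_vec[of _ k d]) auto
      also have "\<dots> = 0\<^sub>v k" using isometry_transpose_mult[OF L cL(2)] cL(2) by simp
      finally have "q \<bullet> p = 0"
        using transpose_vec_mult_scalar[OF L(1) cL(1) cL(4)] cL(1) by (simp add: p_def)
      then show ?thesis using comm_scalar_prod[OF cL(3,4)] by simp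
    qed
    moreover have "p \<bullet> p \<le> c\<^sup>2 * (w \<bullet> w)"
    proof -
      define e where "e = U\<^sup>T *\<^sub>v w"
      have e: "e \<in> carrier_vec n" using U(1) cy by (auto simp: e_def)
      \<comment> \<open>\<open>h\<close> is the point of the graph over the leading coordinates of
        \<open>e\<close>. As \<open>w\<close> is orthogonal to the range of \<open>B\<close>, also
        \<open>e \<bullet> h = 0\<close>, so \<open>?a\<close> is minus the trailing part of this
        product. Cauchy-Schwarz and the slope of \<open>h\<close> then give
        \<open>?a \<le> f\<^sup>2 * ?b\<close>, after cancelling a factor \<open>?a\<close>.\<close>
      obtain h where h: "h \<in> H" "\<forall>i<k. h $ i = e $ i" using onto[OF e] by blast
      have hn: "h \<in> carrier_vec n" using h H by auto
      let ?a = "\<Sum>i<k. e $ i * e $ i" and ?b = "\<Sum>i\<in>{k..<n}. e $ i * e $ i"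
      have "U *\<^sub>v h \<in> range_mat B" using ran h by auto
      then obtain v where v: "v \<in> carrier_vec r" "U *\<^sub>v h = B *\<^sub>v v"
        using range_mat_eq[OF B(1)] by auto
      have "B\<^sup>T *\<^sub>v w = B\<^sup>T *\<^sub>v x - B\<^sup>T *\<^sub>v (B *\<^sub>v (B\<^sup>T *\<^sub>v x))"
        unfolding w_def y_def using B(1) x cy by (intro mult_minus_distrib_mat_vec[of _ r d]) auto
      also have "\<dots> = 0\<^sub>v r" using isometry_transpose_mult[OF B cy(1)] cy(1) by simp
      finally have "w \<bullet> (B *\<^sub>v v) = 0" using transpose_vec_mult_scalar[OF B(1) v(1) cy(3)] v(1) by simp
      then have "e \<bullet> h = 0"
        using transpose_vec_mult_scalar[OF U(1) hn cy(3)] v by (simp add: e_def)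
      then have "?a = - (\<Sum>i\<in>{k..<n}. e $ i * h $ i)"
        using scalar_prod_split[OF e hn k] h(2) by simp
      then have "?a\<^sup>2 = (\<Sum>i\<in>{k..<n}. e $ i * h $ i)\<^sup>2" by simp
      also have "\<dots> \<le> ?b * (\<Sum>i\<in>{k..<n}. h $ i * h $ i)"
        using Cauchy_Schwarz_ineq_sum[of "\<lambda>i. e $ i" "\<lambda>i. h $ i" "{k..<n}"]
        by (simp add: power2_eq_square)
      also have "\<dots> \<le> ?b * (f\<^sup>2 * ?a)"
        using slope[OF h(1)] h(2) by (intro mult_left_mono) (auto intro: sum_nonneg)
      finally have *: "?a * ?a \<le> ?a * (f\<^sup>2 * ?b)" by (simp add: power2_eq_square algebra_simps)
      have nn: "0 \<le> ?a" "0 \<le> ?b" by (auto intro: sum_nonneg)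
      have "?a \<le> f\<^sup>2 * ?b"
      proof (cases "?a = 0")
        case True
        show ?thesis unfolding True using nn by simp
      next
        case False
        then have "0 < ?a" using nn(1) by linarith
        from mult_le_cancel_left_pos[OF this] show ?thesis using * by blast
      qed
      then have "?a \<le> c\<^sup>2 * (?b + ?a)" by (rule scale)
      also have "?b + ?a = e \<bullet> e" using scalar_prod_split[OF e e k] by simp
      \<comment> \<open>When \<open>n < d\<close>, \<open>w\<close> may leave the range of
        \<open>U\<close>, so its coordinate vector \<open>e\<close> can be shorter than
        \<open>w\<close> and only Bessel's inequality is available.\<close>
      also have "c\<^sup>2 * (e \<bullet> e) \<le> c\<^sup>2 * (w \<bullet> w)"
        unfolding e_def by (intro mult_left_mono bessel_inequality[OF U cy(3)]) simp
      also have "?a = p \<bullet> p"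
        unfolding p_def isometry_scalar_prod[OF L cL(1) cL(1)] Lx[OF cy(3)] e_def ..
      finally show ?thesis .
    qed
    moreover have "q \<bullet> q \<le> c\<^sup>2 * (y \<bullet> y)"
    proof -
      have "y \<in> range_mat B" using range_mat_eq[OF B(1)] cy by (auto simp: y_def)
      then obtain h where h: "h \<in> H" "y = U *\<^sub>v h" using ran by auto
      have hn: "h \<in> carrier_vec n" using h H by auto
      have yh: "U\<^sup>T *\<^sub>v y = h" "y \<bullet> y = h \<bullet> h"
        using h isometry_transpose_mult[OF U hn] isometry_scalar_prod[OF U hn hn] by auto
      \<comment> \<open>Subtracting from \<open>U *\<^sub>v h\<close> its projection onto the first
        \<open>k\<close> columns leaves exactly the trailing coordinates of
        \<open>h\<close>.\<close>
      have "q \<bullet> q = (\<Sum>i\<in>{k..<n}. h $ i * h $ i)"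
        unfolding q_def projection_residual_norm[OF L cy(2)] Lx[OF cy(2)] yh
        using scalar_prod_split[OF hn hn k] by simp
      also have "\<dots> \<le> c\<^sup>2 * ((\<Sum>i<k. h $ i * h $ i) + (\<Sum>i\<in>{k..<n}. h $ i * h $ i))"
        by (rule scale[OF slope[OF h(1)]])
      finally show ?thesis using yh scalar_prod_split[OF hn hn k] by simp
    qed
    \<comment> \<open>Orthogonality of \<open>p\<close> and \<open>q\<close> removes the cross term;
      \<open>ww\<close> then recombines the two parts into \<open>x \<bullet> x\<close>.\<close>
    ultimately have "((L * L\<^sup>T - B * B\<^sup>T) *\<^sub>v x) \<bullet> ((L * L\<^sup>T - B * B\<^sup>T) *\<^sub>v x)
        \<le> c\<^sup>2 * (w \<bullet> w) + c\<^sup>2 * (y \<bullet> y)"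
      using scalar_prod_self_minus[OF cL(3,4)] by simp
    also have "\<dots> = c\<^sup>2 * (x \<bullet> x)" unfolding ww by (simp add: right_diff_distrib)
    finally show ?thesis using vec_norm2_le_iff[OF c(1)] by simp
  qed
  have "spectral_norm (L * L\<^sup>T - B * B\<^sup>T) \<le> c"
    using bound B(1) by (intro spectral_norm_leI c) auto
  then show ?thesis
    unfolding subspace_dist_def L_def[symmetric] orth_projector_range[OF L] orth_projector_range[OF B] c_def .
qed

section \<open>Ranges of products and nonsingular factors\<close>

lemma range_mat_mult:
  fixes C B :: "real Matrix.mat"
  assumes "C \<in> carrier_mat d e" "B \<in> carrier_mat e r"
  shows "range_mat (C * B) = (\<lambda>x. C *\<^sub>v x) ` range_mat B"
proof -
  have "(C * B) *\<^sub>v x = C *\<^sub>v (B *\<^sub>v x)" if "x \<in> carrier_vec r" for x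
    using assms that by (rule assoc_mult_mat_vec)
  then show ?thesis
    using range_mat_eq[OF assms(2)] range_mat_eq[of "C * B" d r] assms by (auto simp: image_image)
qed

lemma det_nonzero_inverse:
  fixes T :: "real Matrix.mat"
  assumes T: "T \<in> carrier_mat n n" and det: "det T \<noteq> 0"
  shows "the (mat_inverse T) \<in> carrier_mat n n" "T * the (mat_inverse T) = 1\<^sub>m n"
    "the (mat_inverse T) * T = 1\<^sub>m n"
proof -
  obtain S where "mat_inverse T = Some S"
    using mat_inverse(1)[OF T] det_non_zero_imp_unit[OF T det] by fastforce
  from mat_inverse(2)[OF T this] this
  show "the (mat_inverse T) \<in> carrier_mat n n" "T * the (mat_inverse T) = 1\<^sub>m n"
    "the (mat_inverse T) * T = 1\<^sub>m n"
    by auto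
qed

lemma det_nonzero_iff_inj:
  fixes T :: "real Matrix.mat"
  assumes "T \<in> carrier_mat n n"
  shows "det T \<noteq> 0 \<longleftrightarrow> (\<forall>u\<in>carrier_vec n. T *\<^sub>v u = 0\<^sub>v n \<longrightarrow> u = 0\<^sub>v n)"
  using det_0_iff_vec_prod_zero_field[OF assms] by blast

lemma range_mat_mult_nonsingular:
  fixes Y T :: "real Matrix.mat"
  assumes Y: "Y \<in> carrier_mat d r" and T: "T \<in> carrier_mat r r" "det T \<noteq> 0"
  shows "range_mat (Y * T) = range_mat Y"
proof -
  define S where "S = the (mat_inverse T)"
  have S: "S \<in> carrier_mat r r" "T * S = 1\<^sub>m r" using det_nonzero_inverse[OF T] by (auto simp: S_def)
  have "range_mat T = carrier_vec r"
  proof -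
    have "x = T *\<^sub>v (S *\<^sub>v x)" "S *\<^sub>v x \<in> carrier_vec r" if "x \<in> carrier_vec r" for x
      using T S that assoc_mult_mat_vec[of T r r S r x] by auto
    then show ?thesis using range_mat_eq[OF T(1)] T(1) by auto
  qed
  then show ?thesis using range_mat_mult[OF Y T(1)] range_mat_eq[OF Y] by simp
qed

section \<open>Leading columns of a QR factorization\<close>

text \<open>Since \<open>R\<close> is upper triangular, the first \<open>k\<close> columns of
  \<open>X\<close> are those of \<open>Q\<close> times the leading block \<open>T\<close> of
  \<open>R\<close>. Injectivity of these columns of \<open>X\<close> makes \<open>T\<close>
  nonsingular. Without it the range on the left, of dimension \<open>k\<close>, would be strictly
  larger.\<close>

lemma reduced_qr_left_range:
  assumes qr: "reduced_qr X Q R" and X: "X \<in> carrier_mat d n" and k: "k \<le> n"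
    and inj: "\<And>u. u \<in> carrier_vec k \<Longrightarrow> left_cols k X *\<^sub>v u = 0\<^sub>v d \<Longrightarrow> u = 0\<^sub>v k"
  shows "range_mat (left_cols k Q) = range_mat (left_cols k X)"
proof -
  have Q: "Q \<in> carrier_mat d n" and R: "R \<in> carrier_mat n n" "upper_triangular R" and XQR: "X = Q * R"
    using qr X unfolding reduced_qr_def by auto
  define T where "T = top_rows k (left_cols k R)"
  have T: "T \<in> carrier_mat k k" and L: "left_cols k Q \<in> carrier_mat d k"
    using R Q by (auto simp: T_def top_rows_def left_cols_def)
  have XT: "left_cols k X = left_cols k Q * T"
  proof (rule eq_matI)
    fix i j assume "i < dim_row (left_cols k Q * T)" "j < dim_col (left_cols k Q * T)"
    then have ij: "i < d" "j < k" using L T by auto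
    have "left_cols k X $$ (i, j) = (\<Sum>l<n. Q $$ (i, l) * R $$ (l, j))"
      using ij Q R k by (simp add: XQR left_cols_def scalar_prod_lessThan)
    also have "\<dots> = (\<Sum>l<k. Q $$ (i, l) * R $$ (l, j))"
    proof -
      have "R $$ (l, j) = 0" if "l \<in> {k..<n}" for l
        using R that ij unfolding upper_triangular_def by auto
      then show ?thesis unfolding sum_lessThan_split[OF k] by simp
    qed
    also have "\<dots> = (left_cols k Q * T) $$ (i, j)"
      using ij Q R k by (simp add: T_def top_rows_def left_cols_def scalar_prod_lessThan)
    finally show "left_cols k X $$ (i, j) = (left_cols k Q * T) $$ (i, j)" .
  qed (use X L T in \<open>auto simp: left_cols_def\<close>)
  have "det T \<noteq> 0"
    unfolding det_nonzero_iff_inj[OF T]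
  proof (intro ballI impI)
    fix u :: "real Matrix.vec" assume u: "u \<in> carrier_vec k" "T *\<^sub>v u = 0\<^sub>v k"
    have "left_cols k X *\<^sub>v u = left_cols k Q *\<^sub>v (T *\<^sub>v u)"
      unfolding XT by (rule assoc_mult_mat_vec[OF L T u(1)])
    also have "\<dots> = 0\<^sub>v d" using u(2) L by auto
    finally show "u = 0\<^sub>v k" by (rule inj[OF u(1)])
  qed
  from range_mat_mult_nonsingular[OF L T this] show ?thesis unfolding XT by simp
qed

text \<open>Passes from one factorization to the next. The leading columns \<open>B\<close> of the
  previous orthogonal factor are known only through their range, that of \<open>Y\<close>; this
  fixes the range of \<open>C * B\<close>, and injectivity of \<open>C * Y\<close> transfers to
  \<open>C * B\<close> because \<open>B\<close> is injective.\<close>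

lemma reduced_qr_mult_left_range:
  fixes C B Y :: "real Matrix.mat"
  assumes qr: "reduced_qr X Q R" and X: "X \<in> carrier_mat d n" and k: "k \<le> n"
    and XC: "left_cols k X = C * B" and C: "C \<in> carrier_mat d e"
    and B: "B \<in> carrier_mat e k" "B\<^sup>T * B = 1\<^sub>m k"
    and Y: "Y \<in> carrier_mat e k" and ran: "range_mat B = range_mat Y"
    and inj: "\<And>u. u \<in> carrier_vec k \<Longrightarrow> (C * Y) *\<^sub>v u = 0\<^sub>v d \<Longrightarrow> u = 0\<^sub>v k"
  shows "range_mat (left_cols k Q) = range_mat (C * Y)"
proof -
  have "range_mat (left_cols k Q) = range_mat (left_cols k X)"
  proof (rule reduced_qr_left_range[OF qr X k])
    fix u :: "real Matrix.vec" assume u: "u \<in> carrier_vec k" and 0: "left_cols k X *\<^sub>v u = 0\<^sub>v d"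
    have "B *\<^sub>v u \<in> range_mat Y" using ran u range_mat_eq[OF B(1)] by auto
    then obtain z where z: "z \<in> carrier_vec k" "B *\<^sub>v u = Y *\<^sub>v z" using range_mat_eq[OF Y] by auto
    have "(C * Y) *\<^sub>v z = C *\<^sub>v (B *\<^sub>v u)" using z assoc_mult_mat_vec[OF C Y z(1)] by simp
    also have "\<dots> = 0\<^sub>v d" using 0 assoc_mult_mat_vec[OF C B(1) u] XC by simp
    finally have "z = 0\<^sub>v k" by (rule inj[OF z(1)])
    then have "B *\<^sub>v u = 0\<^sub>v e" using z Y by auto
    then show "u = 0\<^sub>v k" using isometry_transpose_mult[OF B u] B(1) by auto
  qed
  then show ?thesis unfolding XC using range_mat_mult[OF C B(1)] range_mat_mult[OF C Y] ran by simp
qed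

section \<open>Graphs in singular coordinates\<close>

lemma isometry_inj:
  fixes U :: "real Matrix.mat"
  assumes "U \<in> carrier_mat d n" "U\<^sup>T * U = 1\<^sub>m n" "u \<in> carrier_vec n" "U *\<^sub>v u = 0\<^sub>v d"
  shows "u = 0\<^sub>v n"
  using isometry_transpose_mult[OF assms(1-3)] assms(1,4) by auto

lemma top_rows_mult_vec:
  assumes "M \<in> carrier_mat n r" "z \<in> carrier_vec r" "k \<le> n" "i < k"
  shows "(top_rows k M *\<^sub>v z) $ i = (M *\<^sub>v z) $ i"
  using assms by (auto simp: top_rows_def scalar_prod_def)

lemma bottom_rows_mult_vec:
  assumes "M \<in> carrier_mat n r" "z \<in> carrier_vec r" "i < n - k"
  shows "(bottom_rows k M *\<^sub>v z) $ i = (M *\<^sub>v z) $ (i + k)"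
  using assms by (auto simp: bottom_rows_def scalar_prod_def)

lemma mat_diag_mult_vec:
  fixes d :: "nat \<Rightarrow> real"
  assumes "W \<in> carrier_mat n r" "z \<in> carrier_vec r" "i < n"
  shows "((mat_diag n d * W) *\<^sub>v z) $ i = d i * (W *\<^sub>v z) $ i"
  using assms by (simp add: mat_diag_mult_left[OF assms(1)] scalar_prod_lessThan sum_distrib_left mult.assoc)

text \<open>Before scaling, the trailing coordinates of \<open>W *\<^sub>v z\<close> are the image
  of the leading ones under the bottom block times the inverse of the top block, so its spectral
  norm bounds the slope. The diagonal stretches trailing coordinates by at most \<open>b\<close> and
  leading ones by at least \<open>a\<close>.\<close>

lemma diag_graph_slope:
  fixes W :: "real Matrix.mat" and d :: "nat \<Rightarrow> real"
  assumes W: "W \<in> carrier_mat n k" and k: "k \<le> n" and inv: "det (top_rows k W) \<noteq> 0"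
    and z: "z \<in> carrier_vec k" and a: "0 < a" and b: "0 \<le> b"
    and top: "\<And>i. i < k \<Longrightarrow> a \<le> d i"
    and bot: "\<And>i. k \<le> i \<Longrightarrow> i < n \<Longrightarrow> \<bar>d i\<bar> \<le> b"
    and h: "h = (mat_diag n d * W) *\<^sub>v z"
  shows "(\<Sum>i\<in>{k..<n}. h $ i * h $ i)
    \<le> (b / a * spectral_norm (bottom_rows k W * the (mat_inverse (top_rows k W))))\<^sup>2 * (\<Sum>i<k. h $ i * h $ i)"
proof -
  define T where "T = top_rows k W"
  define S where "S = the (mat_inverse T)"
  define \<nu> where "\<nu> = spectral_norm (bottom_rows k W * S)"
  define y where "y = W *\<^sub>v z"
  have T: "T \<in> carrier_mat k k" using W by (simp add: T_def top_rows_carrier)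
  have S: "S \<in> carrier_mat k k" "S * T = 1\<^sub>m k"
    using det_nonzero_inverse[OF T] inv by (auto simp: S_def T_def)
  have Bo: "bottom_rows k W \<in> carrier_mat (n - k) k" using W by (rule bottom_rows_carrier)
  have hi: "h $ i = d i * y $ i" if "i < n" for i
    unfolding h y_def using W z that by (rule mat_diag_mult_vec)
  have Tz: "T *\<^sub>v z \<in> carrier_vec k" using T z by auto
  have "bottom_rows k W *\<^sub>v z = bottom_rows k W *\<^sub>v ((S * T) *\<^sub>v z)" using S z by simp
  also have "\<dots> = (bottom_rows k W * S) *\<^sub>v (T *\<^sub>v z)"
    unfolding assoc_mult_mat_vec[OF S(1) T z] assoc_mult_mat_vec[OF Bo S(1) Tz] ..
  finally have bz: "bottom_rows k W *\<^sub>v z = (bottom_rows k W * S) *\<^sub>v (T *\<^sub>v z)" .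
  have "vec_norm2 (bottom_rows k W *\<^sub>v z) \<le> \<nu> * vec_norm2 (T *\<^sub>v z)"
    unfolding bz \<nu>_def using S Tz by (intro vec_norm2_mult_mat_vec_le) auto
  then have "(bottom_rows k W *\<^sub>v z) \<bullet> (bottom_rows k W *\<^sub>v z) \<le> \<nu>\<^sup>2 * ((T *\<^sub>v z) \<bullet> (T *\<^sub>v z))"
    by (subst (asm) vec_norm2_le_iff) (simp_all add: \<nu>_def spectral_norm_nonneg)
  also have "(bottom_rows k W *\<^sub>v z) \<bullet> (bottom_rows k W *\<^sub>v z) = (\<Sum>i<n - k. y $ (i + k) * y $ (i + k))"
    using bottom_rows_mult_vec[OF W z] Bo by (simp add: scalar_prod_lessThan[of "_ *\<^sub>v _"] y_def del: index_mult_mat_vec)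
  also have "\<dots> = (\<Sum>i\<in>{k..<n}. y $ i * y $ i)"
    by (rule sum.reindex_bij_witness[of _ "\<lambda>i. i - k" "\<lambda>i. i + k"]) auto
  also have "(T *\<^sub>v z) \<bullet> (T *\<^sub>v z) = (\<Sum>i<k. y $ i * y $ i)"
    using top_rows_mult_vec[OF W z k] T by (simp add: scalar_prod_lessThan[of "_ *\<^sub>v _"] y_def T_def del: index_mult_mat_vec)
  finally have yy: "(\<Sum>i\<in>{k..<n}. y $ i * y $ i) \<le> \<nu>\<^sup>2 * (\<Sum>i<k. y $ i * y $ i)" .
  have "(\<Sum>i\<in>{k..<n}. h $ i * h $ i) \<le> (\<Sum>i\<in>{k..<n}. b\<^sup>2 * (y $ i * y $ i))"
  proof (rule sum_mono)
    fix i assume i: "i \<in> {k..<n}"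
    have "(d i)\<^sup>2 \<le> b\<^sup>2" using bot[of i] i b by (auto simp: abs_le_square_iff[symmetric])
    from mult_right_mono[OF this, of "y $ i * y $ i"]
    show "h $ i * h $ i \<le> b\<^sup>2 * (y $ i * y $ i)" using hi[of i] i by (simp add: power2_eq_square algebra_simps)
  qed
  also have "\<dots> = b\<^sup>2 * (\<Sum>i\<in>{k..<n}. y $ i * y $ i)" by (simp add: sum_distrib_left)
  also have "\<dots> \<le> b\<^sup>2 * (\<nu>\<^sup>2 * (\<Sum>i<k. y $ i * y $ i))" using yy by (intro mult_left_mono) auto
  also have "\<dots> = (b / a * \<nu>)\<^sup>2 * (\<Sum>i<k. a\<^sup>2 * (y $ i * y $ i))"
    using a by (simp add: sum_distrib_left[symmetric] power_mult_distrib power_divide)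
  also have "\<dots> \<le> (b / a * \<nu>)\<^sup>2 * (\<Sum>i<k. h $ i * h $ i)"
  proof (intro mult_left_mono sum_mono)
    fix i assume i: "i \<in> {..<k}"
    have "a\<^sup>2 \<le> (d i)\<^sup>2" using top[of i] i a by (auto intro: power_mono)
    from mult_right_mono[OF this, of "y $ i * y $ i"]
    show "a\<^sup>2 * (y $ i * y $ i) \<le> h $ i * h $ i" using hi[of i] i k by (simp add: power2_eq_square algebra_simps)
  qed simp
  finally show ?thesis by (simp add: \<nu>_def S_def T_def)
qed

lemma diag_graph_onto:
  fixes W :: "real Matrix.mat" and d :: "nat \<Rightarrow> real"
  assumes W: "W \<in> carrier_mat n k" and k: "k \<le> n" and inv: "det (top_rows k W) \<noteq> 0"
    and top: "\<And>i. i < k \<Longrightarrow> d i \<noteq> 0"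
  shows "\<exists>z\<in>carrier_vec k. \<forall>i<k. ((mat_diag n d * W) *\<^sub>v z) $ i = c $ i"
proof -
  define T where "T = top_rows k W"
  define S where "S = the (mat_inverse T)"
  have T: "T \<in> carrier_mat k k" using W by (simp add: T_def top_rows_carrier)
  have S: "S \<in> carrier_mat k k" "T * S = 1\<^sub>m k"
    using det_nonzero_inverse[OF T] inv by (auto simp: S_def T_def)
  \<comment> \<open>Undo the diagonal scaling first, then solve with the invertible top
    block.\<close>
  define y where "y = Matrix.vec k (\<lambda>i. c $ i / d i)"
  have y: "y \<in> carrier_vec k" "S *\<^sub>v y \<in> carrier_vec k" using S by (auto simp: y_def)
  have "T *\<^sub>v (S *\<^sub>v y) = y" using S T y assoc_mult_mat_vec[of T k k S k y] by simp
  then have "(W *\<^sub>v (S *\<^sub>v y)) $ i = c $ i / d i" if "i < k" for i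
    using top_rows_mult_vec[OF W y(2) k that] that by (simp add: T_def y_def)
  then have "((mat_diag n d * W) *\<^sub>v (S *\<^sub>v y)) $ i = c $ i" if "i < k" for i
    using mat_diag_mult_vec[OF W y(2), of i d] that k top[OF that] by simp
  then show ?thesis using y(2) by blast
qed

lemma diag_graph_inj:
  fixes W :: "real Matrix.mat" and d :: "nat \<Rightarrow> real"
  assumes W: "W \<in> carrier_mat n k" and k: "k \<le> n" and inv: "det (top_rows k W) \<noteq> 0"
    and top: "\<And>i. i < k \<Longrightarrow> d i \<noteq> 0"
    and z: "z \<in> carrier_vec k" "(mat_diag n d * W) *\<^sub>v z = 0\<^sub>v n"
  shows "z = 0\<^sub>v k"
proof -
  have T: "top_rows k W \<in> carrier_mat k k" using W by (simp add: top_rows_carrier)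
  have "top_rows k W *\<^sub>v z = 0\<^sub>v k"
  proof (rule eq_vecI)
    fix i assume "i < dim_vec (0\<^sub>v k :: real Matrix.vec)"
    then have i: "i < k" by simp
    have "d i * (W *\<^sub>v z) $ i = 0" using mat_diag_mult_vec[OF W z(1), of i d] z(2) i k by simp
    then show "(top_rows k W *\<^sub>v z) $ i = 0\<^sub>v k $ i"
      using top_rows_mult_vec[OF W z(1) k i] top[OF i] i by simp
  qed (use T in auto)
  then show ?thesis using inv z(1) det_nonzero_iff_inj[OF T] by blast
qed

lemma subspace_dist_diag_le:
  fixes U B W :: "real Matrix.mat"
  assumes U: "U \<in> carrier_mat d n" "U\<^sup>T * U = 1\<^sub>m n" and k: "1 \<le> k" "k < n"
    and B: "B \<in> carrier_mat d k" "B\<^sup>T * B = 1\<^sub>m k"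
    and W: "W \<in> carrier_mat n k" and inv: "det (top_rows k W) \<noteq> 0"
    and pos: "0 < \<sigma> k" and nonneg: "\<And>i. i \<in> {1..n} \<Longrightarrow> 0 \<le> \<sigma> i"
    and decr: "\<And>i j. 1 \<le> i \<Longrightarrow> i \<le> j \<Longrightarrow> j \<le> n \<Longrightarrow> \<sigma> j \<le> \<sigma> i"
    and ran: "range_mat B = range_mat (U * (mat_diag n (\<lambda>i. \<sigma> (Suc i) ^ j) * W))"
    and f: "f = (\<sigma> (k + 1) / \<sigma> k) ^ j
      * spectral_norm (bottom_rows k W * the (mat_inverse (top_rows k W)))"
  shows "subspace_dist d (range_mat (left_cols k U)) (range_mat B) \<le> f / sqrt (1 + f\<^sup>2)"
proof -
  let ?d = "\<lambda>i. \<sigma> (Suc i) ^ j"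
  let ?M = "mat_diag n ?d * W"
  have M: "?M \<in> carrier_mat n k" by (rule mult_carrier_mat[OF mat_diag_dim W])
  \<comment> \<open>Coordinates count from 0 but singular values from 1: coordinate \<open>i\<close>
    carries \<open>\<sigma> (Suc i)\<close>. So \<open>i < k\<close> gives at least
    \<open>\<sigma> k\<close>, and \<open>k \<le> i\<close> gives at most
    \<open>\<sigma> (k + 1)\<close>.\<close>
  have top: "\<sigma> k ^ j \<le> ?d i" if "i < k" for i
    using decr[of "Suc i" k] that pos k by (auto intro: power_mono)
  show ?thesis
  proof (rule subspace_dist_graph_le[OF U _ B, of k "range_mat ?M"])
    show "range_mat ?M \<subseteq> carrier_vec n" using range_mat_eq[OF M] M by auto
    show "range_mat B = (\<lambda>h. U *\<^sub>v h) ` range_mat ?M" unfolding ran by (rule range_mat_mult[OF U(1) M])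
    show "0 \<le> f" unfolding f using pos nonneg[of "k + 1"] k by (simp add: spectral_norm_nonneg)
    show "(\<Sum>i\<in>{k..<n}. h $ i * h $ i) \<le> f\<^sup>2 * (\<Sum>i<k. h $ i * h $ i)" if h: "h \<in> range_mat ?M" for h
    proof -
      obtain z where z: "z \<in> carrier_vec k" "h = ?M *\<^sub>v z"
        using h unfolding range_mat_eq[OF M] by blast
      have "\<bar>?d i\<bar> \<le> \<sigma> (k + 1) ^ j" if "k \<le> i" "i < n" for i
        using decr[of "k + 1" "Suc i"] nonneg[of "Suc i"] that k by (auto simp: power_abs intro!: power_mono)
      then show ?thesis
        using diag_graph_slope[OF W _ inv z(1) _ _ top _ z(2)] pos nonneg[of "k + 1"] k
        by (simp add: f power_divide)
    qed
    show "\<exists>h\<in>range_mat ?M. \<forall>i<k. h $ i = c $ i" for c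
    proof -
      have "?d i \<noteq> 0" if "i < k" for i using top[OF that] zero_less_power[OF pos, of j] by linarith
      from diag_graph_onto[where d = ?d and c = c, OF W less_imp_le[OF k(2)] inv this] show ?thesis
        unfolding range_mat_eq[OF M] by blast
    qed
  qed (use k in simp)
qed

section \<open>Distances of complementary subspaces\<close>

lemma left_right_cols_decomp:
  fixes U :: "real Matrix.mat"
  assumes U: "U \<in> carrier_mat d n" and k: "k \<le> n"
  shows "left_cols k U * (left_cols k U)\<^sup>T + right_cols k U * (right_cols k U)\<^sup>T = U * U\<^sup>T"
proof (rule eq_matI)
  fix i j assume "i < dim_row (U * U\<^sup>T)" "j < dim_col (U * U\<^sup>T)"
  then have ij: "i < d" "j < d" using U by auto
  let ?g = "\<lambda>l. U $$ (i, l) * U $$ (j, l)"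
  have "(\<Sum>l<n - k. ?g (l + k)) = (\<Sum>l\<in>{k..<n}. ?g l)"
    by (rule sum.reindex_bij_witness[of _ "\<lambda>i. i - k" "\<lambda>i. i + k"]) auto
  moreover have "(\<Sum>l<n. ?g l) = (\<Sum>l<k. ?g l) + (\<Sum>l\<in>{k..<n}. ?g l)"
    by (rule sum_lessThan_split[OF k])
  ultimately show "(left_cols k U * (left_cols k U)\<^sup>T + right_cols k U * (right_cols k U)\<^sup>T) $$ (i, j)
      = (U * U\<^sup>T) $$ (i, j)"
    using ij U k by (simp add: left_cols_def right_cols_def scalar_prod_lessThan)
qed (use U in \<open>auto simp: left_cols_def right_cols_def\<close>)

lemma vec_norm2_uminus: "vec_norm2 (- v) = vec_norm2 v"
  by (simp add: vec_norm2_def scalar_prod_lessThan)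

lemma spectral_norm_uminus: "spectral_norm (- M) = spectral_norm M"
proof -
  have "(- M) *\<^sub>v x = - (M *\<^sub>v x)" if "x \<in> carrier_vec (dim_col M)" for x
    using that by (intro eq_vecI) (auto simp: scalar_prod_def sum_negf)
  then have "{vec_norm2 (- M *\<^sub>v x) | x. x \<in> carrier_vec (dim_col M) \<and> vec_norm2 x \<le> 1}
      = {vec_norm2 (M *\<^sub>v x) | x. x \<in> carrier_vec (dim_col M) \<and> vec_norm2 x \<le> 1}"
    using vec_norm2_uminus by metis
  then show ?thesis by (simp add: spectral_norm_def)
qed

lemma complementary_minus:
  fixes A B C D :: "real Matrix.mat"
  assumes c: "A \<in> carrier_mat d d" "B \<in> carrier_mat d d" "C \<in> carrier_mat d d" "D \<in> carrier_mat d d"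
    and sum: "A + B = C + D"
  shows "B - D = - (A - C)"
proof (rule eq_matI)
  fix i j assume "i < dim_row (- (A - C))" "j < dim_col (- (A - C))"
  then have ij: "i < d" "j < d" using c by auto
  then have "A $$ (i, j) + B $$ (i, j) = C $$ (i, j) + D $$ (i, j)"
    using arg_cong[OF sum, of "\<lambda>M. M $$ (i, j)"] c by simp
  then show "(B - D) $$ (i, j) = (- (A - C)) $$ (i, j)" using ij c by simp
qed (use c in auto)

text \<open>The projectors of the two column blocks add up to the projector onto the whole range. If
  \<open>U\<close> and \<open>Q\<close> share that sum, the differences of the left and of the right
  projectors are negatives of each other.\<close>

lemma subspace_dist_right_cols:
  fixes U Q :: "real Matrix.mat"
  assumes U: "U \<in> carrier_mat d n" "U\<^sup>T * U = 1\<^sub>m n" and Q: "Q \<in> carrier_mat d n" "Q\<^sup>T * Q = 1\<^sub>m n"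
    and k: "k \<le> n" and eq: "U * U\<^sup>T = Q * Q\<^sup>T"
  shows "subspace_dist d (range_mat (right_cols k U)) (range_mat (right_cols k Q))
    = subspace_dist d (range_mat (left_cols k U)) (range_mat (left_cols k Q))"
proof -
  let ?P = "\<lambda>M :: real Matrix.mat. M * M\<^sup>T"
  note UQ = left_cols_carrier[OF U(1), of k] right_cols_carrier[OF U(1), of k]
    left_cols_carrier[OF Q(1), of k] right_cols_carrier[OF Q(1), of k]
  have c: "?P (left_cols k U) \<in> carrier_mat d d" "?P (right_cols k U) \<in> carrier_mat d d"
    "?P (left_cols k Q) \<in> carrier_mat d d" "?P (right_cols k Q) \<in> carrier_mat d d"
    using UQ by auto
  have sum: "?P (left_cols k U) + ?P (right_cols k U) = ?P (left_cols k Q) + ?P (right_cols k Q)"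
    using left_right_cols_decomp[OF U(1) k] left_right_cols_decomp[OF Q(1) k] eq by simp
  have "?P (right_cols k U) - ?P (right_cols k Q) = - (?P (left_cols k U) - ?P (left_cols k Q))"
    by (rule complementary_minus[OF c sum])
  then show ?thesis
    unfolding subspace_dist_def
      orth_projector_range[OF UQ(1) left_cols_isometry[OF U k]]
      orth_projector_range[OF UQ(2) right_cols_isometry[OF U k]]
      orth_projector_range[OF UQ(3) left_cols_isometry[OF Q k]]
      orth_projector_range[OF UQ(4) right_cols_isometry[OF Q k]]
    by (simp add: spectral_norm_uminus)
qed


section \<open>The three factorizations of Rand-QLP\<close>

lemma mat_diag_inj:
  fixes d :: "nat \<Rightarrow> real"
  assumes W: "W \<in> carrier_mat n r" and d: "\<And>i. i < n \<Longrightarrow> d i \<noteq> 0"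
    and z: "z \<in> carrier_vec r" "(mat_diag n d * W) *\<^sub>v z = 0\<^sub>v n"
  shows "W *\<^sub>v z = 0\<^sub>v n"
proof (rule eq_vecI)
  fix i assume "i < dim_vec (0\<^sub>v n :: real Matrix.vec)"
  then show "(W *\<^sub>v z) $ i = 0\<^sub>v n $ i"
    using mat_diag_mult_vec[OF W z(1), of i d] z(2) d[of i] by simp
qed (use W in auto)

text \<open>Each multiplication by \<open>A\<close> or its transpose contributes one more power of
  the singular values, whence exponent 2 for \<open>Q\<close> and 3 for \<open>P\<close>. Passing to
  trailing columns requires equal total ranges: automatic for the square orthogonal \<open>V\<close>
  and \<open>P\<close>, but for \<open>U\<close> and \<open>Q\<close> a consequence of the case
  assumption.\<close>

lemma rand_qlp_subspace_dist_le:
  fixes A U V \<Omega> Q L P :: "real Matrix.mat" and \<sigma> :: "nat \<Rightarrow> real" and m n k :: nat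
  assumes k: "1 \<le> k" "k < n" and A: "A \<in> carrier_mat m n" and \<Omega>: "\<Omega> \<in> carrier_mat m n"
    and svd: "thin_svd A U \<sigma> V" and pos: "0 < \<sigma> k"
    and qlp: "rand_qlp A \<Omega> Q L P"
    and W: "W = U\<^sup>T * left_cols k \<Omega>" and inv: "det (top_rows k W) \<noteq> 0"
    and f: "\<And>j. f j = (\<sigma> (k + 1) / \<sigma> k) ^ j
      * spectral_norm (bottom_rows k W * the (mat_inverse (top_rows k W)))"
  shows "subspace_dist m (range_mat (left_cols k U)) (range_mat (left_cols k Q)) \<le> f 2 / sqrt (1 + (f 2)\<^sup>2)"
    and "subspace_dist n (range_mat (left_cols k V)) (range_mat (left_cols k P)) \<le> f 3 / sqrt (1 + (f 3)\<^sup>2)"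
    and "m = n \<or> \<sigma> n > 0 \<or> range_mat Q = range_mat U \<Longrightarrow>
      subspace_dist m (range_mat (right_cols k U)) (range_mat (right_cols k Q)) \<le> f 2 / sqrt (1 + (f 2)\<^sup>2)"
    and "subspace_dist n (range_mat (right_cols k V)) (range_mat (right_cols k P)) \<le> f 3 / sqrt (1 + (f 3)\<^sup>2)"
proof -
  define D where "D j = mat_diag n (\<lambda>i. \<sigma> (Suc i) ^ j)" for j
  define M where "M j = D j * W" for j
  have dims: "dim_row A = m" "dim_col A = n" using A by auto
  have U: "U \<in> carrier_mat m n" "U\<^sup>T * U = 1\<^sub>m n" and V: "V \<in> carrier_mat n n" "V\<^sup>T * V = 1\<^sub>m n"
    and nonneg: "\<And>i. i \<in> {1..n} \<Longrightarrow> 0 \<le> \<sigma> i"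
    and decr: "\<And>i j. 1 \<le> i \<Longrightarrow> i \<le> j \<Longrightarrow> j \<le> n \<Longrightarrow> \<sigma> j \<le> \<sigma> i"
    and AUDV: "A = U * D 1 * V\<^sup>T"
    using svd unfolding thin_svd_def dims by (auto simp: D_def)
  have kn: "k \<le> n" using k by simp
  have D: "D j \<in> carrier_mat n n" for j by (simp add: D_def)
  have Dt: "(D j)\<^sup>T = D j" for j by (auto simp: D_def mat_diag_def)
  have O1: "left_cols k \<Omega> \<in> carrier_mat m k" by (rule left_cols_carrier[OF \<Omega>])
  have Wc: "W \<in> carrier_mat n k" unfolding W using U(1) O1 by auto
  have Mc: "M j \<in> carrier_mat n k" for j unfolding M_def by (rule mult_carrier_mat[OF D Wc])
  have M_Suc: "D 1 * M j = M (Suc j)" for j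
    unfolding M_def assoc_mult_mat[OF D D Wc, symmetric] by (simp add: D_def)
  have At: "A\<^sup>T = V * (D 1 * U\<^sup>T)"
  proof -
    have "A\<^sup>T = (V\<^sup>T)\<^sup>T * (U * D 1)\<^sup>T"
      unfolding AUDV using U(1) V(1) D by (intro transpose_mult[of _ m n _ n]) auto
    also have "(U * D 1)\<^sup>T = D 1 * U\<^sup>T" using transpose_mult[OF U(1) D] Dt by simp
    finally show ?thesis by simp
  qed
  have A_mult: "A * Y = U * (D 1 * (V\<^sup>T * Y))" if Y: "Y \<in> carrier_mat n c" for Y :: "real Matrix.mat" and c
  proof -
    have "A * Y = (U * D 1) * (V\<^sup>T * Y)"
      unfolding AUDV using U(1) V(1) D Y by (intro assoc_mult_mat[of _ m n _ n _ c]) auto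
    also have "\<dots> = U * (D 1 * (V\<^sup>T * Y))"
      using U(1) V(1) D Y by (intro assoc_mult_mat[of _ m n _ n _ c]) auto
    finally show ?thesis .
  qed
  have At_mult: "A\<^sup>T * Y = V * (D 1 * (U\<^sup>T * Y))" if Y: "Y \<in> carrier_mat m c" for Y :: "real Matrix.mat" and c
  proof -
    have "A\<^sup>T * Y = V * ((D 1 * U\<^sup>T) * Y)"
      unfolding At using U(1) V(1) D[of 1] Y by (intro assoc_mult_mat[of _ n n _ m _ c]) auto
    also have "(D 1 * U\<^sup>T) * Y = D 1 * (U\<^sup>T * Y)"
      using U(1) D Y by (intro assoc_mult_mat[of _ n n _ m _ c]) auto
    finally show ?thesis .
  qed
  have At\<Omega>: "A\<^sup>T * left_cols k \<Omega> = V * M 1"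
    using At_mult[OF O1] by (simp add: W M_def)
  have AVM: "A * (V * M j) = U * M (Suc j)" for j
  proof -
    have "V\<^sup>T * (V * M j) = M j"
      using V Mc[of j] assoc_mult_mat[of "V\<^sup>T" n n V n "M j" k] by simp
    then show ?thesis using A_mult[OF mult_carrier_mat[OF V(1) Mc]] M_Suc by simp
  qed
  have AtUM: "A\<^sup>T * (U * M j) = V * M (Suc j)" for j
  proof -
    have "U\<^sup>T * (U * M j) = M j"
      using U Mc[of j] assoc_mult_mat[of "U\<^sup>T" n m U n "M j" k] by simp
    then show ?thesis using At_mult[OF mult_carrier_mat[OF U(1) Mc]] M_Suc by simp
  qed
  \<comment> \<open>Full column rank for all three factorizations at once: the first
    \<open>k\<close> singular values are positive and the top block of \<open>W\<close> is
    nonsingular.\<close>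
  have inj: "u = 0\<^sub>v k"
    if X: "X \<in> carrier_mat d n" "X\<^sup>T * X = 1\<^sub>m n" and u: "u \<in> carrier_vec k" "(X * M j) *\<^sub>v u = 0\<^sub>v d"
    for X :: "real Matrix.mat" and d j u
  proof -
    have "X *\<^sub>v (M j *\<^sub>v u) = 0\<^sub>v d" using u assoc_mult_mat_vec[OF X(1) Mc u(1)] by simp
    then have 0: "M j *\<^sub>v u = 0\<^sub>v n" by (rule isometry_inj[OF X mult_mat_vec_carrier[OF Mc u(1)]])
    have "\<sigma> (Suc i) ^ j \<noteq> 0" if "i < k" for i
      using decr[of "Suc i" k] that pos k by auto
    from diag_graph_inj[where d = "\<lambda>i. \<sigma> (Suc i) ^ j", OF Wc kn inv this u(1) 0[unfolded M_def D_def]]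
    show ?thesis .
  qed
  from qlp obtain Qb Rb Rh R where
    qr1: "reduced_qr (A\<^sup>T * \<Omega>) Qb Rb" and qr2: "reduced_qr (A * Qb) Q Rh" and qr3: "reduced_qr (A\<^sup>T * Q) P R"
    unfolding rand_qlp_def by blast
  have Qb: "Qb \<in> carrier_mat n n" "Qb\<^sup>T * Qb = 1\<^sub>m n"
    using qr1 A \<Omega> unfolding reduced_qr_def by auto
  have Q: "Q \<in> carrier_mat m n" "Q\<^sup>T * Q = 1\<^sub>m n"
    using qr2 A Qb unfolding reduced_qr_def by auto
  have P: "P \<in> carrier_mat n n" "P\<^sup>T * P = 1\<^sub>m n"
    using qr3 A Q unfolding reduced_qr_def by auto
  have AT: "A\<^sup>T \<in> carrier_mat n m" using A by simp
  note VM = mult_carrier_mat[OF V(1) Mc] and UM = mult_carrier_mat[OF U(1) Mc]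
  have r1: "range_mat (left_cols k Qb) = range_mat (V * M 1)"
    using reduced_qr_left_range[OF qr1 mult_carrier_mat[OF AT \<Omega>] kn] inj[OF V]
    unfolding left_cols_mult[OF AT \<Omega> kn] At\<Omega> by blast
  have r2: "range_mat (left_cols k Q) = range_mat (U * M 2)"
    using reduced_qr_mult_left_range[OF qr2 mult_carrier_mat[OF A Qb(1)] kn left_cols_mult[OF A Qb(1) kn] A
      left_cols_carrier[OF Qb(1)] left_cols_isometry[OF Qb kn] VM r1] inj[OF U]
    unfolding AVM by (simp add: numeral_2_eq_2)
  have r3: "range_mat (left_cols k P) = range_mat (V * M 3)"
    using reduced_qr_mult_left_range[OF qr3 mult_carrier_mat[OF AT Q(1)] kn left_cols_mult[OF AT Q(1) kn] AT
      left_cols_carrier[OF Q(1)] left_cols_isometry[OF Q kn] UM r2] inj[OF V]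
    unfolding AtUM by (simp add: numeral_3_eq_3)
  show Qle: "subspace_dist m (range_mat (left_cols k U)) (range_mat (left_cols k Q)) \<le> f 2 / sqrt (1 + (f 2)\<^sup>2)"
    using subspace_dist_diag_le[OF U k left_cols_carrier[OF Q(1)] left_cols_isometry[OF Q kn] Wc inv pos
        nonneg decr r2[unfolded M_def D_def] f] by blast
  show Ple: "subspace_dist n (range_mat (left_cols k V)) (range_mat (left_cols k P)) \<le> f 3 / sqrt (1 + (f 3)\<^sup>2)"
    using subspace_dist_diag_le[OF V k left_cols_carrier[OF P(1)] left_cols_isometry[OF P kn] Wc inv pos
        nonneg decr r3[unfolded M_def D_def] f] by blast
  have sq: "X * X\<^sup>T = 1\<^sub>m n" if "X \<in> carrier_mat n n" "X\<^sup>T * X = 1\<^sub>m n" for X :: "real Matrix.mat"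
    using that by (intro mat_mult_left_right_inverse[of "X\<^sup>T"]) auto
  show "subspace_dist n (range_mat (right_cols k V)) (range_mat (right_cols k P)) \<le> f 3 / sqrt (1 + (f 3)\<^sup>2)"
    using Ple subspace_dist_right_cols[OF V P kn] sq[OF V] sq[OF P] by simp
  assume cases: "m = n \<or> \<sigma> n > 0 \<or> range_mat Q = range_mat U"
  \<comment> \<open>With all singular values positive, \<open>A * Qb\<close> is \<open>U\<close>
    times a nonsingular matrix; the lemma on leading columns, used with all \<open>n\<close>
    columns, then identifies the range of \<open>Q\<close>.\<close>
  have full: "range_mat Q = range_mat U" if \<sigma>n: "\<sigma> n > 0"
  proof -
    define S where "S = D 1 * (V\<^sup>T * Qb)"
    have Vt: "V\<^sup>T \<in> carrier_mat n n" "(V\<^sup>T)\<^sup>T * V\<^sup>T = 1\<^sub>m n"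
      using V(1) sq[OF V] by simp_all
    have VQ: "V\<^sup>T * Qb \<in> carrier_mat n n" using V Qb by auto
    have S: "S \<in> carrier_mat n n" unfolding S_def by (rule mult_carrier_mat[OF D VQ])
    have AQ: "A * Qb = U * S" unfolding S_def by (rule A_mult[OF Qb(1)])
    have Sinj: "u = 0\<^sub>v n" if u: "u \<in> carrier_vec n" "S *\<^sub>v u = 0\<^sub>v n" for u
    proof -
      have "\<sigma> (Suc i) ^ 1 \<noteq> 0" if "i < n" for i
        using decr[of "Suc i" n] that \<sigma>n by simp
      from mat_diag_inj[where d = "\<lambda>i. \<sigma> (Suc i) ^ 1", OF VQ this u(1) u(2)[unfolded S_def D_def]]
      have "V\<^sup>T *\<^sub>v (Qb *\<^sub>v u) = 0\<^sub>v n"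
        using assoc_mult_mat_vec[of "V\<^sup>T" n n Qb n u] V(1) Qb(1) u(1) by simp
      then have "Qb *\<^sub>v u = 0\<^sub>v n"
        by (rule isometry_inj[OF Vt mult_mat_vec_carrier[OF Qb(1) u(1)]])
      then show ?thesis using isometry_inj[OF Qb u(1)] by simp
    qed
    have "range_mat (left_cols n Q) = range_mat (left_cols n (A * Qb))"
    proof (rule reduced_qr_left_range[OF qr2 mult_carrier_mat[OF A Qb(1)] le_refl])
      fix u :: "real Matrix.vec"
      assume u: "u \<in> carrier_vec n" and "left_cols n (A * Qb) *\<^sub>v u = 0\<^sub>v m"
      then have "U *\<^sub>v (S *\<^sub>v u) = 0\<^sub>v m"
        using left_cols_all[OF mult_carrier_mat[OF A Qb(1)]] assoc_mult_mat_vec[OF U(1) S u] AQ by simp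
      then have "S *\<^sub>v u = 0\<^sub>v n" using isometry_inj[OF U] S u by auto
      then show "u = 0\<^sub>v n" by (rule Sinj[OF u])
    qed
    then have "range_mat Q = range_mat (U * S)"
      using left_cols_all[OF mult_carrier_mat[OF A Qb(1)]] left_cols_all[OF Q(1)] AQ by simp
    also have "\<dots> = range_mat U"
      using Sinj det_nonzero_iff_inj[OF S] by (intro range_mat_mult_nonsingular[OF U(1) S]) blast
    finally show ?thesis .
  qed
  have "U * U\<^sup>T = Q * Q\<^sup>T"
  proof (cases "m = n")
    case True
    then show ?thesis using sq U Q by simp
  next
    case False
    \<comment> \<open>Equal ranges have the same orthogonal projector, which equals
      \<open>U * U\<^sup>T\<close> as well as \<open>Q * Q\<^sup>T\<close>.\<close>
    then have "range_mat Q = range_mat U" using cases full by blast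
    then show ?thesis using orth_projector_range[OF U] orth_projector_range[OF Q] by simp
  qed
  then show "subspace_dist m (range_mat (right_cols k U)) (range_mat (right_cols k Q)) \<le> f 2 / sqrt (1 + (f 2)\<^sup>2)"
    using Qle subspace_dist_right_cols[OF U Q kn] by simp
qed

text \<open>Probability enters only through the invertibility claim; the bounds hold for each
  outcome separately. The bound on the trailing columns of \<open>Q\<close> is conditional because
  for a tall, rank-deficient \<open>A\<close> these columns may leave the range of \<open>U\<close>.
  For instance, with \<open>m = 3\<close>, \<open>n = 2\<close>, \<open>k = 1\<close>,
  \<open>\<sigma> 2 = 0\<close>, the matrices \<open>U\<close> and \<open>Q\<close> can have columns
  e1, e2 and e1, e3: the bound is 0 but the distance is 1.\<close>

theorem theorem2:
  fixes m n k :: nat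
    and A U V :: "real Matrix.mat"
    and \<sigma> :: "nat \<Rightarrow> real"
    and \<M> :: "'w measure"
    and \<Omega> :: "'w \<Rightarrow> real Matrix.mat"
  assumes dims: "n \<le> m" "k < n" "1 \<le> k"
    and A: "A \<in> carrier_mat m n"
    and svd: "thin_svd A U \<sigma> V"
    and \<sigma>k: "\<sigma> k > 0"
    and \<Omega>: "std_gaussian_matrix \<M> m n \<Omega>"
  shows
    "let \<psi> = \<sigma> (k + 1) / \<sigma> k;
         W1 = (\<lambda>\<omega>. top_rows k (U\<^sup>T * left_cols k (\<Omega> \<omega>)));
         W2 = (\<lambda>\<omega>. bottom_rows k (U\<^sup>T * left_cols k (\<Omega> \<omega>)))
     in (AE \<omega> in \<M>. invertible_mat (W1 \<omega>)) \<and>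
        (\<forall>\<omega> \<in> space \<M>. \<forall>Q L P.
           rand_qlp A (\<Omega> \<omega>) Q L P \<longrightarrow>
           invertible_mat (W1 \<omega>) \<longrightarrow>
           (let L11 = top_rows k (left_cols k L);
                L22 = bottom_rows k (right_cols k L);
                \<nu> = spectral_norm (W2 \<omega> * the (mat_inverse (W1 \<omega>)));
                sin\<theta>Q = subspace_dist m (range_mat (left_cols k U)) (range_mat (left_cols k Q));
                sin\<phi>Q = subspace_dist m (range_mat (right_cols k U)) (range_mat (right_cols k Q));
                sin\<theta>P = subspace_dist n (range_mat (left_cols k V)) (range_mat (left_cols k P));
                sin\<phi>P = subspace_dist n (range_mat (right_cols k V)) (range_mat (right_cols k P))
            in spectral_norm L22 < singular_value L11 k \<longrightarrow>
               sin\<theta>Q \<le> \<psi> ^ 2 * \<nu> \<and>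
               sin\<theta>P \<le> \<psi> ^ 3 * \<nu> \<and>
               ((m = n \<or> \<sigma> n > 0 \<or> range_mat Q = range_mat U) \<longrightarrow>
                  sin\<phi>Q \<le> \<psi> ^ 2 * \<nu> / sqrt (1 + \<psi> ^ 4 * \<nu> ^ 2)) \<and>
               sin\<phi>P \<le> \<psi> ^ 3 * \<nu> / sqrt (1 + \<psi> ^ 6 * \<nu> ^ 2)))"
proof -
  let ?W = "\<lambda>\<omega>. U\<^sup>T * left_cols k (\<Omega> \<omega>)"
  have U: "U \<in> carrier_mat m n" "U\<^sup>T * U = 1\<^sub>m n"
    and nonneg: "\<sigma> (k + 1) \<ge> 0"
    using svd A dims unfolding thin_svd_def by auto
  have ae: "AE \<omega> in \<M>. invertible_mat (top_rows k (?W \<omega>))"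
    using AE_invertible_gaussian_block[OF \<Omega> dims(3) _ dims(1) U] dims(2) by simp
  have bounds: "let \<psi> = \<sigma> (k + 1) / \<sigma> k;
      \<nu> = spectral_norm (bottom_rows k (?W \<omega>) * the (mat_inverse (top_rows k (?W \<omega>))))
    in subspace_dist m (range_mat (left_cols k U)) (range_mat (left_cols k Q)) \<le> \<psi> ^ 2 * \<nu> \<and>
      subspace_dist n (range_mat (left_cols k V)) (range_mat (left_cols k P)) \<le> \<psi> ^ 3 * \<nu> \<and>
      (m = n \<or> \<sigma> n > 0 \<or> range_mat Q = range_mat U \<longrightarrow>
        subspace_dist m (range_mat (right_cols k U)) (range_mat (right_cols k Q))
          \<le> \<psi> ^ 2 * \<nu> / sqrt (1 + \<psi> ^ 4 * \<nu> ^ 2)) \<and>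
      subspace_dist n (range_mat (right_cols k V)) (range_mat (right_cols k P))
        \<le> \<psi> ^ 3 * \<nu> / sqrt (1 + \<psi> ^ 6 * \<nu> ^ 2)"
    if \<omega>: "\<omega> \<in> space \<M>" and qlp: "rand_qlp A (\<Omega> \<omega>) Q L P"
      and inv: "invertible_mat (top_rows k (?W \<omega>))" for \<omega> Q L P
  proof -
    define \<psi> where "\<psi> = \<sigma> (k + 1) / \<sigma> k"
    define \<nu> where "\<nu> = spectral_norm (bottom_rows k (?W \<omega>) * the (mat_inverse (top_rows k (?W \<omega>))))"
    have O: "\<Omega> \<omega> \<in> carrier_mat m n" using \<Omega> \<omega> unfolding std_gaussian_matrix_def by blast
    have "top_rows k (?W \<omega>) \<in> carrier_mat k k"
      using U(1) left_cols_carrier[OF O, of k] by (intro top_rows_carrier[of _ n]) auto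
    then have det: "det (top_rows k (?W \<omega>)) \<noteq> 0" using inv invertible_mat_iff_det by blast
    have f_nonneg: "0 \<le> \<psi> ^ j * \<nu>" for j
      using nonneg \<sigma>k by (simp add: \<psi>_def \<nu>_def spectral_norm_nonneg)
    \<comment> \<open>The leading subspaces satisfy the sharper bound with the square root too; the
      stated one drops a denominator that is at least 1.\<close>
    have le: "x / sqrt (1 + x\<^sup>2) \<le> x" if "0 \<le> x" for x :: real
      using that divide_left_mono[of 1 "sqrt (1 + x\<^sup>2)" x] by (simp add: add_pos_nonneg)
    have sq: "(\<psi> ^ 2 * \<nu>)\<^sup>2 = \<psi> ^ 4 * \<nu> ^ 2" "(\<psi> ^ 3 * \<nu>)\<^sup>2 = \<psi> ^ 6 * \<nu> ^ 2"
      by (simp_all add: power_mult_distrib flip: power_mult)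
    note b = rand_qlp_subspace_dist_le[OF dims(3,2) A O svd \<sigma>k qlp refl det,
        of "\<lambda>j. \<psi> ^ j * \<nu>", unfolded \<psi>_def \<nu>_def, OF refl, folded \<psi>_def \<nu>_def]
    show ?thesis
      unfolding Let_def \<psi>_def[symmetric] \<nu>_def[symmetric]
      using b order_trans[OF b(1) le[OF f_nonneg]] order_trans[OF b(2) le[OF f_nonneg]]
      unfolding sq by blast
  qed
  show ?thesis using ae bounds unfolding Let_def by blast
qed

end
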